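(* Let $2\leq p\leq c\leq q$ be integers and let $K$ be a field. Let $G_{p,c,q}$ be the finite simple graph constructed as follows: let $K_{q-c}$ be the complete graph on $q-c$ vertices; let $H$ be the graph on $c$ vertices (disjoint from those of $K_{q-c}$) whose connected components are a complete graph on $c-(p-1)$ vertices and $p-1$ isolated vertices; and let $G_{p,c,q}$ be obtained from the join $K_{q-c}*H$ by adding a whisker to each vertex. Let $I(G_{p,c,q})^{[k]}$ denote the $k$th squarefree power of the edge ideal of $G_{p,c,q}$ over $K$. Then $I(G_{p,c,q})^{[k]}$ has linear quotients for every integer $k$ with $c\leq k\leq q$, and $I(G_{p,c,q})^{[k]}$ is not linearly related for every integer $k$ with $1\leq k<c$.
   Context: All graphs are finite and simple; the vertices of a graph $G$ are identified with the variables of a polynomial ring $S$ over the field $K$. The edge ideal of $G$ is $I(G)=(xy : \{x,y\}\in E(G))\subset S$. A matching of $G$ is a set of pairwise disjoint edges; a $k$-matching is a matching with $k$ edges; the matching number $\nu(G)$ is the maximal cardinality of a matching. For a matching $M$, $x_M$ is the product of all the variables (vertices) belonging to the edges of $M$. For $1\leq k\leq \nu(G)$, the $k$th squarefree power of $I(G)$ is the squarefree monomial ideal $I(G)^{[k]}=(x_M : M \text{ is a } k\text{-matching of } G)$. The join $G_1*G_2$ of two graphs on disjoint vertex sets has vertex set $V(G_1)\cup V(G_2)$ and edge set $E(G_1)\cup E(G_2)\cup\{\{x,y\}: x\in V(G_1),\, y\in V(G_2)\}$; the complete graph on $0$ vertices is the empty graph, and the join with it leaves the other graph unchanged. Adding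 a whisker to each vertex of a graph means: for each vertex $v$, adding one new vertex $v'$ (distinct for distinct $v$) and the single new edge $\{v,v'\}$. A monomial ideal $I\subset S$ generated in one degree, with set of minimal monomial generators $\{u_1,\dots,u_s\}$, has linear quotients if there is an ordering $u_{i_1},\dots,u_{i_s}$ of the generators such that for each $2\leq j\leq s$ the colon ideal $(u_{i_1},\dots,u_{i_{j-1}}):u_{i_j}$ is generated by variables. A graded ideal $I\subset S$ generated in a single degree is linearly related if the first syzygy module of $I$ (with respect to its minimal homogeneous generators) is generated by linear relations. *)

theory Defs
  imports Main "HOL-Library.Poly_Mapping"
begin

section \<open>Simple graphs\<close>

record 'v ugraph =
  verts :: "'v set"
  edges :: "'v set set"

definition simple_graph :: "'v ugraph \<Rightarrow> bool" where
  "simple_graph G \<longleftrightarrow> finite (verts G) \<and> (\<forall>e\<in>edges G. e \<subseteq> verts G \<and> card e = 2)"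

definition complete_graph :: "'v set \<Rightarrow> 'v ugraph" where
  "complete_graph A = \<lparr>verts = A, edges = {{x, y} | x y. x \<in> A \<and> y \<in> A \<and> x \<noteq> y}\<rparr>"

definition edgeless_graph :: "'v set \<Rightarrow> 'v ugraph" where
  "edgeless_graph A = \<lparr>verts = A, edges = {}\<rparr>"

text \<open>Union and join are only meant for graphs with disjoint vertex sets.\<close>

definition graph_union :: "'v ugraph \<Rightarrow> 'v ugraph \<Rightarrow> 'v ugraph" where
  "graph_union G H = \<lparr>verts = verts G \<union> verts H, edges = edges G \<union> edges H\<rparr>"

definition graph_join :: "'v ugraph \<Rightarrow> 'v ugraph \<Rightarrow> 'v ugraph" where
  "graph_join G H =
    \<lparr>verts = verts G \<union> verts H,
     edges = edges G \<union> edges H \<union> {{x, y} | x y. x \<in> verts G \<and> y \<in> verts H}\<rparr>"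

text \<open>The original vertex \<open>v\<close> becomes \<open>Inl v\<close>; \<open>Inr v\<close> is the new vertex attached to it.\<close>

definition add_whiskers :: "'v ugraph \<Rightarrow> ('v + 'v) ugraph" where
  "add_whiskers G =
    \<lparr>verts = Inl ` verts G \<union> Inr ` verts G,
     edges = ((`) Inl) ` edges G \<union> {{Inl v, Inr v} | v. v \<in> verts G}\<rparr>"

text \<open>
  The vertices of \<open>H\<close> are \<open>0, \<dots>, c - 1\<close> (the first \<open>c - (p - 1)\<close> of them forming the
  complete component), and those of the complete graph on \<open>q - c\<close> vertices are
  \<open>c, \<dots>, q - 1\<close>.
\<close>

definition H_graph :: "nat \<Rightarrow> nat \<Rightarrow> nat ugraph" where
  "H_graph p c =
    graph_union (complete_graph {..<c - (p - 1)}) (edgeless_graph {c - (p - 1)..<c})"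

definition G_graph :: "nat \<Rightarrow> nat \<Rightarrow> nat \<Rightarrow> (nat + nat) ugraph" where
  "G_graph p c q = add_whiskers (graph_join (complete_graph {c..<q}) (H_graph p c))"

definition k_matching :: "'v ugraph \<Rightarrow> nat \<Rightarrow> 'v set set \<Rightarrow> bool" where
  "k_matching G k M \<longleftrightarrow> M \<subseteq> edges G \<and> pairwise disjnt M \<and> finite M \<and> card M = k"


section \<open>Ideals of a polynomial ring in a given set of variables\<close>

text \<open>
  A power product is its exponent function \<open>'v \<Rightarrow>\<^sub>0 nat\<close>. The type below is the polynomial
  ring in all elements of \<open>'v\<close>; the ring \<open>S\<close> with variable set \<open>V\<close> is its subring
  \<open>polyring V\<close>, and all notions that follow are relative to that subring.
\<close>

type_synonym ('v, 'k) mpoly = "('v \<Rightarrow>\<^sub>0 nat) \<Rightarrow>\<^sub>0 'k"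

definition polyring :: "'v set \<Rightarrow> ('v, 'k::comm_ring_1) mpoly set" where
  "polyring V = {f. \<forall>m\<in>Poly_Mapping.keys f. Poly_Mapping.keys m \<subseteq> V}"

definition monom :: "('v \<Rightarrow>\<^sub>0 nat) \<Rightarrow> ('v, 'k::comm_ring_1) mpoly" where
  "monom m = Poly_Mapping.single m 1"

definition var :: "'v \<Rightarrow> ('v, 'k::comm_ring_1) mpoly" where
  "var v = monom (Poly_Mapping.single v 1)"

definition mdeg :: "('v \<Rightarrow>\<^sub>0 nat) \<Rightarrow> nat" where
  "mdeg m = (\<Sum>v\<in>Poly_Mapping.keys m. Poly_Mapping.lookup m v)"

text \<open>As usual, \<open>0\<close> counts as homogeneous of every degree.\<close>

definition homogeneous :: "nat \<Rightarrow> ('v, 'k::comm_ring_1) mpoly \<Rightarrow> bool" where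
  "homogeneous d f \<longleftrightarrow> (\<forall>m\<in>Poly_Mapping.keys f. mdeg m = d)"

definition ideal_gen ::
  "'v set \<Rightarrow> ('v, 'k::comm_ring_1) mpoly set \<Rightarrow> ('v, 'k) mpoly set" where
  "ideal_gen V B =
    {\<Sum>b\<in>T. r b * b | T r. finite T \<and> T \<subseteq> B \<and> (\<forall>b\<in>T. r b \<in> polyring V)}"

definition colon ::
  "'v set \<Rightarrow> ('v, 'k::comm_ring_1) mpoly set \<Rightarrow> ('v, 'k) mpoly \<Rightarrow> ('v, 'k) mpoly set" where
  "colon V I u = {f \<in> polyring V. f * u \<in> I}"

text \<open>
  The monomials of \<open>I\<close> that are minimal with respect to divisibility. A monomial dividing a
  monomial of \<open>S\<close> again lies in \<open>S\<close>, as does the quotient, so \<open>dvd\<close> may be taken in the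
  whole type.
\<close>

definition min_monomial_gens ::
  "('v, 'k::comm_ring_1) mpoly set \<Rightarrow> ('v, 'k) mpoly set" where
  "min_monomial_gens I =
    {u \<in> I \<inter> range monom. \<forall>w \<in> I \<inter> range monom. w dvd u \<longrightarrow> w = u}"

text \<open>
  The third and fourth conjuncts say that \<open>I\<close> is a monomial ideal generated in one degree.
  List positions start at \<open>0\<close>, so \<open>take j us\<close> is the list of the generators that precede
  \<open>us ! j\<close>.
\<close>

definition has_linear_quotients :: "'v set \<Rightarrow> ('v, 'k::comm_ring_1) mpoly set \<Rightarrow> bool" where
  "has_linear_quotients V I \<longleftrightarrow>
    (\<exists>us d. distinct us \<and> set us = min_monomial_gens I \<and>
       ideal_gen V (min_monomial_gens I) = I \<and>
       (\<forall>u\<in>min_monomial_gens I. homogeneous d u) \<and>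
       (\<forall>j. 1 \<le> j \<and> j < length us \<longrightarrow>
          (\<exists>X\<subseteq>V. colon V (ideal_gen V (set (take j us))) (us ! j) = ideal_gen V (var ` X))))"


section \<open>Linearly related ideals\<close>

definition min_homogeneous_gens ::
  "'v set \<Rightarrow> nat \<Rightarrow> ('v, 'k::comm_ring_1) mpoly set \<Rightarrow> ('v, 'k) mpoly set \<Rightarrow> bool" where
  "min_homogeneous_gens V d I F \<longleftrightarrow>
    finite F \<and> F \<subseteq> polyring V \<and> (\<forall>f\<in>F. homogeneous d f) \<and>
    ideal_gen V F = I \<and> (\<forall>F'. F' \<subset> F \<longrightarrow> ideal_gen V F' \<noteq> I)"

text \<open>
  Elements of the free module with basis indexed by \<open>F\<close> are functions vanishing outside \<open>F\<close>.
\<close>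

definition syzygies ::
  "'v set \<Rightarrow> ('v, 'k::comm_ring_1) mpoly set \<Rightarrow> (('v, 'k) mpoly \<Rightarrow> ('v, 'k) mpoly) set" where
  "syzygies V F =
    {a. (\<forall>f\<in>F. a f \<in> polyring V) \<and> (\<forall>f. f \<notin> F \<longrightarrow> a f = 0) \<and> (\<Sum>f\<in>F. a f * f) = 0}"

definition linear_syzygies ::
  "'v set \<Rightarrow> ('v, 'k::comm_ring_1) mpoly set \<Rightarrow> (('v, 'k) mpoly \<Rightarrow> ('v, 'k) mpoly) set" where
  "linear_syzygies V F = {a \<in> syzygies V F. \<forall>f\<in>F. homogeneous 1 (a f)}"

definition submodule_gen ::
  "'v set \<Rightarrow> ('i \<Rightarrow> ('v, 'k::comm_ring_1) mpoly) set \<Rightarrow> ('i \<Rightarrow> ('v, 'k) mpoly) set" where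
  "submodule_gen V B =
    {\<lambda>i. \<Sum>b\<in>T. r b * b i | T r. finite T \<and> T \<subseteq> B \<and> (\<forall>b\<in>T. r b \<in> polyring V)}"

text \<open>
  This is meant for ideals generated in a single degree \<open>d\<close>. For these (over a field) the
  condition does not depend on the system \<open>F\<close> of minimal homogeneous generators. With the
  universal quantifier, the negation asserts that \<open>I\<close> is generated in a single degree and
  has a relation among minimal generators that does not come from linear ones.
\<close>

definition linearly_related :: "'v set \<Rightarrow> ('v, 'k::comm_ring_1) mpoly set \<Rightarrow> bool" where
  "linearly_related V I \<longleftrightarrow>
    (\<forall>d F. min_homogeneous_gens V d I F \<longrightarrow>
       syzygies V F = submodule_gen V (linear_syzygies V F))"


section \<open>Squarefree powers of edge ideals\<close>

definition matching_monomial :: "'v set set \<Rightarrow> ('v, 'k::comm_ring_1) mpoly" where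
  "matching_monomial M = (\<Prod>v\<in>\<Union>M. var v)"

text \<open>The edge ideal \<open>I(G)\<close> itself is the case \<open>k = 1\<close>.\<close>

definition squarefree_power :: "'v ugraph \<Rightarrow> nat \<Rightarrow> ('v, 'k::comm_ring_1) mpoly set" where
  "squarefree_power G k = ideal_gen (verts G) (matching_monomial ` {M. k_matching G k M})"


section \<open>The graph is well formed\<close>

lemma simple_graph_G_graph: "simple_graph (G_graph p c q)"
proof -
  have "card (Inl ` e) = 2" if "card e = 2" for e :: "nat set"
    using that by (simp add: card_image)
  then show ?thesis
    by (fastforce simp: simple_graph_def G_graph_def H_graph_def add_whiskers_def graph_join_def
        graph_union_def complete_graph_def edgeless_graph_def card_2_iff)
qed

lemma card_verts_G_graph:
  assumes "c \<le> q"
  shows "card (verts (G_graph p c q)) = 2 * q"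
proof -
  have V: "verts (graph_join (complete_graph {c..<q}) (H_graph p c)) = {..<q}"
    using assms by (auto simp: H_graph_def graph_join_def graph_union_def complete_graph_def
        edgeless_graph_def)
  have "card (Inl ` {..<q} \<union> Inr ` {..<q} :: (nat + nat) set) = q + q"
    by (subst card_Un_disjoint) (auto simp: card_image)
  then show ?thesis
    using V by (simp add: G_graph_def add_whiskers_def)
qed

end

theory Submission
  imports Defs "HOL-Library.Product_Lexorder"
begin

text \<open>
  Let \<open>B\<close> be the set of the \<open>p - 1\<close> isolated vertices of \<open>H\<close> and \<open>C\<close> the vertex set of the complete
  graph on \<open>q - c\<close> vertices. A generator is determined by its exponent \<open>d v \<in> {0, 1, 2}\<close> in the two
  variables of each whisker. The exponents that occur are those of total degree \<open>2k\<close> for which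
  \<open>d v = 1\<close> happens at most as often on \<open>B\<close> as on \<open>C\<close>.

  For \<open>k \<ge> c\<close>, order the generators lexicographically by the degree on \<open>C\<close>, the number of zeros on
  \<open>C\<close>, and the ternary number with digits \<open>d v\<close>, all ascending. If \<open>i\<close> precedes \<open>j\<close>, one
  unit of \<open>j\<close> can be transferred to a vertex \<open>v\<close> with \<open>i v > j v\<close> so that the result precedes \<open>j\<close>:
  from \<open>C\<close> if there is such a \<open>v\<close> outside \<open>C\<close>, and inside \<open>C\<close> otherwise. Hence the colon
  ideals are generated by variables.

  For \<open>k < c\<close>, take the product \<open>u\<close> of \<open>k\<close> whiskers not meeting \<open>C\<close>, and one more whisker at a
  vertex of \<open>B\<close>. No other generator divides \<open>u z\<close> for a vertex \<open>z\<close> of that whisker, so the relation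
  between \<open>u\<close> and a product of \<open>k\<close> whiskers including the new one is not a combination of linear ones.
\<close>

section \<open>Monomial ideals\<close>

lemma polyring_add: "f \<in> polyring V \<Longrightarrow> g \<in> polyring V \<Longrightarrow> f + g \<in> polyring V"
  using keys_add[of f g] by (fastforce simp: polyring_def)

lemma polyring_mult:
  assumes "f \<in> polyring V" and "g \<in> polyring V"
  shows "f * g \<in> polyring V"
proof -
  have "Poly_Mapping.keys m \<subseteq> V" if "m \<in> Poly_Mapping.keys (f * g)" for m
  proof -
    from that obtain a b where "m = a + b" "a \<in> Poly_Mapping.keys f" "b \<in> Poly_Mapping.keys g"
      using keys_mult[of f g] by blast
    then show ?thesis
      using assms keys_add[of a b] by (fastforce simp: polyring_def)
  qed
  then show ?thesis
    by (auto simp: polyring_def)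
qed

lemma polyring_0: "0 \<in> polyring V"
  by (simp add: polyring_def)

lemma polyring_uminus: "f \<in> polyring V \<Longrightarrow> - f \<in> polyring V"
  by (simp add: polyring_def in_keys_iff)

lemma polyring_sum: "(\<And>x. x \<in> A \<Longrightarrow> f x \<in> polyring V) \<Longrightarrow> sum f A \<in> polyring V"
  by (induction A rule: infinite_finite_induct) (auto simp: polyring_0 polyring_add)

lemma polyring_single: "Poly_Mapping.keys m \<subseteq> V \<Longrightarrow> Poly_Mapping.single m c \<in> polyring V"
  by (auto simp: polyring_def)

lemma keys_monom [simp]: "Poly_Mapping.keys (monom m :: ('v, 'k::comm_ring_1) mpoly) = {m}"
  by (simp add: monom_def)

lemma monom_eq_iff [simp]: "(monom a :: ('v, 'k::comm_ring_1) mpoly) = monom b \<longleftrightarrow> a = b"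
  by (metis keys_monom singleton_inject)

lemma polyring_monom: "monom m \<in> polyring V \<longleftrightarrow> Poly_Mapping.keys m \<subseteq> V"
  by (simp add: polyring_def)

lemma monom_mult: "monom a * monom b = monom (a + b)"
  by (simp add: monom_def mult_single)

lemma monom_0: "monom 0 = 1"
  by (simp add: monom_def)

lemma sum_singles:
  "(\<Sum>m\<in>Poly_Mapping.keys f. Poly_Mapping.single m (Poly_Mapping.lookup f m)) = f"
proof (rule poly_mapping_eqI)
  fix k
  show "Poly_Mapping.lookup (\<Sum>m\<in>Poly_Mapping.keys f. Poly_Mapping.single m (Poly_Mapping.lookup f m)) k
      = Poly_Mapping.lookup f k"
    by (auto simp: lookup_sum lookup_single when_def sum.delta in_keys_iff)
qed

text \<open>Adding \<open>u\<close> to exponents is injective, so multiplication by a monomial never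
  merges two terms of \<open>f\<close>.\<close>

lemma lookup_mult_monom:
  fixes f :: "('v, 'k::comm_ring_1) mpoly"
  shows "Poly_Mapping.lookup (f * monom u) (m + u) = Poly_Mapping.lookup f m"
proof -
  have "f * monom u = (\<Sum>l\<in>Poly_Mapping.keys f. Poly_Mapping.single (l + u) (Poly_Mapping.lookup f l))"
    by (subst (1) sum_singles[symmetric]) (simp add: sum_distrib_right monom_def mult_single)
  then show ?thesis
    by (auto simp: lookup_sum lookup_single when_def sum.delta in_keys_iff)
qed

lemma keys_mult_monom:
  fixes f :: "('v, 'k::comm_ring_1) mpoly"
  shows "Poly_Mapping.keys (f * monom u) = (\<lambda>m. m + u) ` Poly_Mapping.keys f"
proof
  show "Poly_Mapping.keys (f * monom u) \<subseteq> (\<lambda>m. m + u) ` Poly_Mapping.keys f"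
    using keys_mult[of f "monom u"] by auto
  show "(\<lambda>m. m + u) ` Poly_Mapping.keys f \<subseteq> Poly_Mapping.keys (f * monom u)"
    by (auto simp: in_keys_iff lookup_mult_monom)
qed

section \<open>Divisibility and degree of power products\<close>

definition pp_le :: "('v \<Rightarrow>\<^sub>0 nat) \<Rightarrow> ('v \<Rightarrow>\<^sub>0 nat) \<Rightarrow> bool" where
  "pp_le a b \<longleftrightarrow> (\<forall>v. Poly_Mapping.lookup a v \<le> Poly_Mapping.lookup b v)"

lemma pp_le_iff_add: "pp_le a b \<longleftrightarrow> (\<exists>c. b = c + a)"
proof
  assume "pp_le a b"
  then have "b = (b - a) + a"
    by (intro poly_mapping_eqI) (simp add: lookup_add lookup_minus pp_le_def)
  then show "\<exists>c. b = c + a" ..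
qed (auto simp: pp_le_def lookup_add)

lemma pp_le_refl: "pp_le a a"
  by (simp add: pp_le_def)

lemma pp_le_trans: "pp_le a b \<Longrightarrow> pp_le b c \<Longrightarrow> pp_le a c"
  by (meson pp_le_def order_trans)

lemma keys_add_pp: "Poly_Mapping.keys (a + b :: 'v \<Rightarrow>\<^sub>0 nat) = Poly_Mapping.keys a \<union> Poly_Mapping.keys b"
  by (auto simp: in_keys_iff lookup_add)

lemma mdeg_superset:
  assumes "finite A" and "Poly_Mapping.keys m \<subseteq> A"
  shows "mdeg m = (\<Sum>v\<in>A. Poly_Mapping.lookup m v)"
  unfolding mdeg_def using assms by (intro sum.mono_neutral_left) (auto simp: in_keys_iff)

lemma mdeg_add: "mdeg (a + b) = mdeg a + mdeg b"
proof -
  let ?A = "Poly_Mapping.keys a \<union> Poly_Mapping.keys b"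
  have "mdeg a = (\<Sum>v\<in>?A. Poly_Mapping.lookup a v)" "mdeg b = (\<Sum>v\<in>?A. Poly_Mapping.lookup b v)"
    by (rule mdeg_superset; simp)+
  then show ?thesis
    by (simp add: mdeg_def keys_add_pp lookup_add sum.distrib)
qed

lemma mdeg_eq_0: "mdeg m = 0 \<longleftrightarrow> m = 0"
proof
  assume "mdeg m = 0"
  then have "\<forall>v\<in>Poly_Mapping.keys m. Poly_Mapping.lookup m v = 0"
    unfolding mdeg_def by (subst (asm) sum_eq_0_iff) simp_all
  then show "m = 0"
    by (metis keys_eq_empty all_not_in_conv in_keys_iff)
qed (simp add: mdeg_def)

lemma mdeg_eq_1:
  assumes "mdeg m = 1"
  obtains z where "m = Poly_Mapping.single z 1"
proof -
  have "Poly_Mapping.keys m \<noteq> {}"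
    using assms by (metis mdeg_def sum.empty zero_neq_one)
  then obtain z where "z \<in> Poly_Mapping.keys m"
    by blast
  then have "pp_le (Poly_Mapping.single z 1) m"
    by (auto simp: pp_le_def lookup_single when_def in_keys_iff)
  then obtain c where c: "m = c + Poly_Mapping.single z 1"
    by (auto simp: pp_le_iff_add)
  moreover have "mdeg (Poly_Mapping.single z 1) = 1"
    by (simp add: mdeg_def)
  ultimately have "mdeg c = 0"
    using assms by (simp only: mdeg_add)
  then have "m = Poly_Mapping.single z 1"
    using c by (simp add: mdeg_eq_0)
  then show thesis ..
qed

lemma pp_le_mdeg_eq: "pp_le a b \<Longrightarrow> mdeg a = mdeg b \<Longrightarrow> a = b"
  by (auto simp: pp_le_iff_add mdeg_add mdeg_eq_0)

section \<open>Membership in monomial ideals\<close>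

lemma ideal_gen_0: "0 \<in> ideal_gen V B"
  unfolding ideal_gen_def by (rule CollectI, rule exI[of _ "{}"]) simp

lemma ideal_gen_multiple: "b \<in> B \<Longrightarrow> r \<in> polyring V \<Longrightarrow> r * b \<in> ideal_gen V B"
  unfolding ideal_gen_def
  by (rule CollectI, rule exI[of _ "{b}"], rule exI[of _ "\<lambda>_. r"]) simp

lemma ideal_gen_add:
  assumes "f \<in> ideal_gen V B" and "g \<in> ideal_gen V B"
  shows "f + g \<in> ideal_gen V B"
proof -
  obtain S r where S: "finite S" "S \<subseteq> B" "\<forall>b\<in>S. r b \<in> polyring V" and f: "f = (\<Sum>b\<in>S. r b * b)"
    using assms(1) by (auto simp: ideal_gen_def)
  obtain T s where T: "finite T" "T \<subseteq> B" "\<forall>b\<in>T. s b \<in> polyring V" and g: "g = (\<Sum>b\<in>T. s b * b)"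
    using assms(2) by (auto simp: ideal_gen_def)
  let ?t = "\<lambda>b. (if b \<in> S then r b else 0) + (if b \<in> T then s b else 0)"
  have "f = (\<Sum>b\<in>S \<union> T. (if b \<in> S then r b else 0) * b)"
    unfolding f using S T by (intro sum.mono_neutral_cong_left) auto
  moreover have "g = (\<Sum>b\<in>S \<union> T. (if b \<in> T then s b else 0) * b)"
    unfolding g using S T by (intro sum.mono_neutral_cong_left) auto
  ultimately have "f + g = (\<Sum>b\<in>S \<union> T. ?t b * b)"
    by (simp only: sum.distrib distrib_right)
  moreover have "\<forall>b\<in>S \<union> T. ?t b \<in> polyring V"
    using S(3) T(3) by (intro ballI polyring_add) (simp_all add: polyring_0)
  moreover have "finite (S \<union> T)" "S \<union> T \<subseteq> B"
    using S T by auto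
  ultimately show ?thesis
    unfolding ideal_gen_def by (intro CollectI exI[of _ "S \<union> T"] exI[of _ ?t] conjI)
qed

lemma ideal_gen_sum: "(\<And>x. x \<in> A \<Longrightarrow> f x \<in> ideal_gen V B) \<Longrightarrow> sum f A \<in> ideal_gen V B"
  by (induction A rule: infinite_finite_induct) (auto simp: ideal_gen_0 ideal_gen_add)

text \<open>A term of a combination of generators already occurs in one summand, where it is a
  multiple of the generator; conversely \<open>f\<close> is the sum of its terms. Questions about
  these ideals thereby become questions about exponents.\<close>

lemma mem_ideal_gen_monom_iff:
  fixes f :: "('v, 'k::comm_ring_1) mpoly"
  assumes E: "\<forall>e\<in>E. Poly_Mapping.keys e \<subseteq> V"
  shows "f \<in> ideal_gen V (monom ` E) \<longleftrightarrow>
    f \<in> polyring V \<and> (\<forall>m\<in>Poly_Mapping.keys f. \<exists>e\<in>E. pp_le e m)"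
proof
  assume "f \<in> ideal_gen V (monom ` E)"
  then obtain T r where T: "finite T" "T \<subseteq> monom ` E" "\<forall>b\<in>T. r b \<in> polyring V"
    and f: "f = (\<Sum>b\<in>T. r b * b)"
    by (auto simp: ideal_gen_def)
  have "f \<in> polyring V"
    unfolding f
  proof (rule polyring_sum)
    fix b assume b: "b \<in> T"
    then obtain e where "e \<in> E" "b = monom e"
      using T by auto
    then show "r b * b \<in> polyring V"
      using b T E by (intro polyring_mult) (auto simp: polyring_monom)
  qed
  moreover have "\<exists>e\<in>E. pp_le e m" if m: "m \<in> Poly_Mapping.keys f" for m
  proof -
    obtain b where b: "b \<in> T" "m \<in> Poly_Mapping.keys (r b * b)"
      using m unfolding f by (auto simp: in_keys_iff lookup_sum elim: sum.not_neutral_contains_not_neutral)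
    then obtain e where "e \<in> E" "b = monom e"
      using T by auto
    then show ?thesis
      using b by (auto simp: keys_mult_monom pp_le_iff_add)
  qed
  ultimately show "f \<in> polyring V \<and> (\<forall>m\<in>Poly_Mapping.keys f. \<exists>e\<in>E. pp_le e m)"
    by blast
next
  assume f: "f \<in> polyring V \<and> (\<forall>m\<in>Poly_Mapping.keys f. \<exists>e\<in>E. pp_le e m)"
  have "(\<Sum>m\<in>Poly_Mapping.keys f. Poly_Mapping.single m (Poly_Mapping.lookup f m))
      \<in> ideal_gen V (monom ` E)"
  proof (rule ideal_gen_sum)
    fix m assume m: "m \<in> Poly_Mapping.keys f"
    then obtain e c where e: "e \<in> E" "m = c + e"
      using f by (auto simp: pp_le_iff_add)
    have "Poly_Mapping.keys m \<subseteq> V"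
      using f m by (auto simp: polyring_def)
    then have "Poly_Mapping.single c (Poly_Mapping.lookup f m) * monom e \<in> ideal_gen V (monom ` E)"
      using e by (intro ideal_gen_multiple polyring_single) (auto simp: keys_add_pp)
    then show "Poly_Mapping.single m (Poly_Mapping.lookup f m) \<in> ideal_gen V (monom ` E)"
      using e(2) by (simp add: monom_def mult_single)
  qed
  then show "f \<in> ideal_gen V (monom ` E)"
    by (simp add: sum_singles)
qed

text \<open>A monomial of the ideal that divides a generator is in turn divisible by a generator;
  both generators have degree \<open>d\<close>, so all three coincide.\<close>

lemma min_monomial_gens_monom:
  fixes E :: "('v \<Rightarrow>\<^sub>0 nat) set"
  assumes E: "\<forall>e\<in>E. Poly_Mapping.keys e \<subseteq> V" and deg: "\<And>e. e \<in> E \<Longrightarrow> mdeg e = d"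
  shows "min_monomial_gens (ideal_gen V (monom ` E) :: ('v, 'k::comm_ring_1) mpoly set) = monom ` E"
proof (intro set_eqI iffI)
  fix u :: "('v, 'k) mpoly"
  assume u: "u \<in> min_monomial_gens (ideal_gen V (monom ` E))"
  then obtain m where m: "u = monom m"
    by (auto simp: min_monomial_gens_def)
  with u obtain e where e: "e \<in> E" "pp_le e m"
    using E by (auto simp: min_monomial_gens_def mem_ideal_gen_monom_iff)
  then obtain c where "m = c + e"
    by (auto simp: pp_le_iff_add)
  then have "u = monom e * monom c"
    by (simp add: m monom_mult add.commute)
  then have "monom e dvd u" ..
  moreover have "(monom e :: ('v, 'k) mpoly) \<in> ideal_gen V (monom ` E)"
    using e(1) E by (auto simp: mem_ideal_gen_monom_iff polyring_monom intro: pp_le_refl)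
  ultimately have "monom e = u"
    using u by (auto simp: min_monomial_gens_def)
  then show "u \<in> monom ` E"
    using e by auto
next
  fix u :: "('v, 'k) mpoly"
  assume "u \<in> monom ` E"
  then obtain e where e: "e \<in> E" "u = monom e"
    by auto
  have "w = u" if w: "w \<in> ideal_gen V (monom ` E) \<inter> range monom" "w dvd u" for w
  proof -
    obtain m where m: "w = monom m"
      using w by auto
    then obtain e' where e': "e' \<in> E" "pp_le e' m"
      using w E by (auto simp: mem_ideal_gen_monom_iff)
    obtain r where "u = r * monom m"
      using w m by (auto simp: dvd_def mult.commute)
    then have "e \<in> (\<lambda>l. l + m) ` Poly_Mapping.keys r"
      by (metis e(2) keys_monom keys_mult_monom singletonI)
    then have le: "pp_le m e"
      by (auto simp: pp_le_iff_add)
    then have "e' = e"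
      using e e' deg by (intro pp_le_mdeg_eq) (auto intro: pp_le_trans)
    then have "m = e"
      using le e' by (auto simp: pp_le_def intro!: poly_mapping_eqI order.antisym)
    then show ?thesis
      using m e by simp
  qed
  then show "u \<in> min_monomial_gens (ideal_gen V (monom ` E))"
    using e E by (auto simp: min_monomial_gens_def mem_ideal_gen_monom_iff polyring_monom intro: pp_le_refl)
qed

section \<open>Exponents of squarefree monomials\<close>

definition ind :: "'v set \<Rightarrow> 'v \<Rightarrow>\<^sub>0 nat" where
  "ind U = (\<Sum>v\<in>U. Poly_Mapping.single v 1)"

lemma lookup_ind: "finite U \<Longrightarrow> Poly_Mapping.lookup (ind U) v = of_bool (v \<in> U)"
  by (simp add: ind_def lookup_sum lookup_single when_def)

lemma keys_ind: "finite U \<Longrightarrow> Poly_Mapping.keys (ind U) = U"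
  by (auto simp: in_keys_iff lookup_ind)

lemma mdeg_ind: "finite U \<Longrightarrow> mdeg (ind U) = card U"
  by (simp add: mdeg_def keys_ind lookup_ind)

lemma ind_eq_iff: "finite U \<Longrightarrow> finite W \<Longrightarrow> ind U = ind W \<longleftrightarrow> U = W"
  by (metis keys_ind)

lemma prod_var: "(\<Prod>v\<in>U. var v) = monom (ind U)"
  by (induction U rule: infinite_finite_induct)
    (simp_all add: ind_def monom_0 monom_mult var_def)

text \<open>The exponents of \<open>ind W\<close> are at most 1, so the square that arises when
  \<open>z\<close> already lies in \<open>U\<close> does no harm.\<close>

lemma pp_le_ind_add_single:
  assumes "finite U" and "finite W"
  shows "pp_le (ind W) (Poly_Mapping.single z 1 + ind U) \<longleftrightarrow> W \<subseteq> insert z U"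
  using assms by (auto simp: pp_le_def lookup_add lookup_ind lookup_single when_def of_bool_def)

section \<open>Linear quotients and linear relations of squarefree monomial ideals\<close>

text \<open>Suppose \<open>x_W'\<close> divides \<open>m x_U\<close>. The variable \<open>z\<close>
  given by \<open>exchange\<close> lies in \<open>W'\<close> but not in \<open>U\<close>, so it
  divides \<open>m\<close>; and \<open>z\<close> itself is in the colon ideal because
  \<open>x_W\<close> divides \<open>z x_U\<close>.\<close>

lemma colon_squarefree_eq_vars:
  fixes \<U> :: "'v set set"
  assumes V: "finite V" "\<And>W. W \<in> \<U> \<Longrightarrow> W \<subseteq> V" "U \<subseteq> V"
    and exchange: "\<And>W'. W' \<in> \<U> \<Longrightarrow> \<exists>z\<in>W' - U. \<exists>W\<in>\<U>. W \<subseteq> insert z U"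
  shows "colon V (ideal_gen V (monom ` ind ` \<U>)) (monom (ind U)) =
    (ideal_gen V (var ` {z\<in>V. \<exists>W\<in>\<U>. W \<subseteq> insert z U}) :: ('v, 'k::comm_ring_1) mpoly set)"
proof -
  let ?X = "{z\<in>V. \<exists>W\<in>\<U>. W \<subseteq> insert z U}"
  let ?s = "\<lambda>z. Poly_Mapping.single z (1::nat)"
  have fin: "finite U" "\<And>W. W \<in> \<U> \<Longrightarrow> finite W"
    using V by (auto intro: finite_subset)
  have vars: "var ` ?X = (monom ` ?s ` ?X :: ('v, 'k) mpoly set)"
    by (simp add: var_def image_image)
  have iff: "(\<exists>e\<in>ind ` \<U>. pp_le e (m + ind U)) \<longleftrightarrow> (\<exists>e\<in>?s ` ?X. pp_le e m)" for m
  proof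
    assume "\<exists>e\<in>ind ` \<U>. pp_le e (m + ind U)"
    then obtain W' where W': "W' \<in> \<U>" "pp_le (ind W') (m + ind U)"
      by auto
    then obtain z W where z: "z \<in> W' - U" "W \<in> \<U>" "W \<subseteq> insert z U"
      using exchange by blast
    have "Poly_Mapping.lookup (ind W') z \<le> Poly_Mapping.lookup (m + ind U) z"
      using W' by (simp add: pp_le_def)
    then have "1 \<le> Poly_Mapping.lookup m z"
      using z W' fin by (simp add: lookup_add lookup_ind)
    then have "pp_le (?s z) m"
      by (auto simp: pp_le_def lookup_single when_def)
    moreover have "z \<in> ?X"
      using z W' V by blast
    ultimately show "\<exists>e\<in>?s ` ?X. pp_le e m"
      by blast
  next
    assume "\<exists>e\<in>?s ` ?X. pp_le e m"
    then obtain z W where z: "W \<in> \<U>" "W \<subseteq> insert z U" "pp_le (?s z) m"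
      by auto
    then have "pp_le (ind W) (?s z + ind U)"
      using fin by (simp only: pp_le_ind_add_single)
    moreover have "pp_le (?s z + ind U) (m + ind U)"
      using z by (simp add: pp_le_def lookup_add)
    ultimately show "\<exists>e\<in>ind ` \<U>. pp_le e (m + ind U)"
      using z(1) by (blast intro: pp_le_trans)
  qed
  have keysU: "\<forall>e\<in>ind ` \<U>. Poly_Mapping.keys e \<subseteq> V"
    using fin V(2) by (fastforce simp: keys_ind)
  have keysX: "\<forall>e\<in>?s ` ?X. Poly_Mapping.keys e \<subseteq> V"
    by auto
  have monomU: "(monom (ind U) :: ('v, 'k) mpoly) \<in> polyring V"
    using fin V(3) by (simp add: polyring_monom keys_ind)
  show ?thesis
  proof (rule set_eqI)
    fix f :: "('v, 'k) mpoly"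
    have "f \<in> colon V (ideal_gen V (monom ` ind ` \<U>)) (monom (ind U)) \<longleftrightarrow>
        f \<in> polyring V \<and> (\<forall>m\<in>Poly_Mapping.keys f. \<exists>e\<in>ind ` \<U>. pp_le e (m + ind U))"
      using polyring_mult[OF _ monomU, of f]
      unfolding colon_def mem_Collect_eq mem_ideal_gen_monom_iff[OF keysU] keys_mult_monom by blast
    then show "f \<in> colon V (ideal_gen V (monom ` ind ` \<U>)) (monom (ind U)) \<longleftrightarrow>
        f \<in> ideal_gen V (var ` ?X)"
      unfolding vars mem_ideal_gen_monom_iff[OF keysX] iff .
  qed
qed

text \<open>When the generators are listed by increasing \<open>rank\<close>, the predecessors of
  \<open>S j\<close> are those of smaller rank, and \<open>exchange\<close> becomes the hypothesis
  of \<open>colon_squarefree_eq_vars\<close>.\<close>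

lemma has_linear_quotients_squarefree:
  fixes S :: "'i \<Rightarrow> 'v set" and rank :: "'i \<Rightarrow> 'r::linorder"
  assumes V: "finite V" "\<And>i. i \<in> D \<Longrightarrow> S i \<subseteq> V" and card: "\<And>i. i \<in> D \<Longrightarrow> card (S i) = n"
    and D: "finite D" "inj_on S D" "inj_on rank D"
    and exchange: "\<And>i j. i \<in> D \<Longrightarrow> j \<in> D \<Longrightarrow> rank i < rank j \<Longrightarrow>
      \<exists>z\<in>S i - S j. \<exists>l\<in>D. rank l < rank j \<and> S l \<subseteq> insert z (S j)"
  shows "has_linear_quotients V
    (ideal_gen V (monom ` ind ` S ` D) :: ('v, 'k::comm_ring_1) mpoly set)"
proof -
  \<comment> \<open>Sort the ranks and pull them back along the injective
    \<open>rank\<close>.\<close>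
  define ds where "ds = map (the_inv_into D rank) (sorted_list_of_set (rank ` D))"
  have "map rank ds = sorted_list_of_set (rank ` D)"
    unfolding ds_def map_map using D by (intro map_idI) (auto simp: f_the_inv_into_f)
  then have sorted: "sorted_wrt (<) (map rank ds)"
    by simp
  then have "distinct ds"
    by (simp add: strict_sorted_iff distinct_map)
  moreover have "set ds = D"
    using D by (simp add: ds_def the_inv_into_onto)
  ultimately have ds: "set ds = D" "distinct ds" "sorted_wrt (<) (map rank ds)"
    using sorted by simp_all
  let ?m = "\<lambda>i. monom (ind (S i)) :: ('v, 'k) mpoly"
  have fin: "finite (S i)" if "i \<in> D" for i
    using V that by (meson finite_subset)
  have gens: "min_monomial_gens (ideal_gen V (monom ` ind ` S ` D) :: ('v, 'k) mpoly set)
      = monom ` ind ` S ` D"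
    by (rule min_monomial_gens_monom[where d = n]) (use V(2) card fin in \<open>fastforce simp: keys_ind mdeg_ind\<close>)+
  have inj: "inj_on ?m D"
    using D(2) fin by (auto simp: inj_on_def ind_eq_iff)
  show ?thesis
    unfolding has_linear_quotients_def gens
  proof (intro exI[of _ "map ?m ds"] exI[of _ n] conjI)
    show "distinct (map ?m ds)"
      using ds inj by (simp add: distinct_map)
    show "set (map ?m ds) = monom ` ind ` S ` D"
      using ds by (simp add: image_image)
    show "\<forall>u\<in>monom ` ind ` S ` D. homogeneous n u"
      using fin card by (auto simp: homogeneous_def mdeg_ind)
    show "\<forall>j. 1 \<le> j \<and> j < length (map ?m ds) \<longrightarrow>
      (\<exists>X\<subseteq>V. colon V (ideal_gen V (set (take j (map ?m ds)))) (map ?m ds ! j) = ideal_gen V (var ` X))"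
    proof (intro allI impI)
      fix j assume "1 \<le> j \<and> j < length (map ?m ds)"
      then have j: "j < length ds"
        by simp
      define E where "E = set (take j ds)"
      have E: "i \<in> E \<longleftrightarrow> i \<in> D \<and> rank i < rank (ds ! j)" for i
      proof
        assume "i \<in> E"
        then obtain l where "l < j" "i = ds ! l"
          using j by (auto simp: E_def in_set_conv_nth)
        then show "i \<in> D \<and> rank i < rank (ds ! j)"
          using j ds sorted_wrt_nth_less[OF ds(3), of l j] by auto
      next
        assume i: "i \<in> D \<and> rank i < rank (ds ! j)"
        then obtain l where l: "l < length ds" "i = ds ! l"
          using ds(1) by (metis in_set_conv_nth)
        have "l < j"
        proof (rule ccontr)
          assume "\<not> l < j"
          then have "rank (ds ! j) \<le> rank (ds ! l)"
            using l j sorted_wrt_nth_less[OF ds(3), of j l] by (cases "l = j") auto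
          then show False
            using i l leD by blast
        qed
        then show "i \<in> E"
          using l j by (auto simp: E_def in_set_conv_nth)
      qed
      have j': "ds ! j \<in> D"
        using ds(1) j nth_mem by blast
      have take: "set (take j (map ?m ds)) = monom ` ind ` S ` E"
        by (simp add: E_def take_map image_image)
      have "colon V (ideal_gen V (monom ` ind ` S ` E)) (?m (ds ! j)) =
        (ideal_gen V (var ` {z\<in>V. \<exists>W\<in>S ` E. W \<subseteq> insert z (S (ds ! j))}) :: ('v, 'k) mpoly set)"
      proof (rule colon_squarefree_eq_vars)
        show "\<exists>z\<in>W' - S (ds ! j). \<exists>W\<in>S ` E. W \<subseteq> insert z (S (ds ! j))" if "W' \<in> S ` E" for W'
        proof -
          obtain i where "i \<in> E" "W' = S i"
            using \<open>W' \<in> S ` E\<close> by blast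
          then show ?thesis
            using exchange[of i "ds ! j"] j' E by (metis image_eqI)
        qed
      qed (use V j' E in auto)
      then show "\<exists>X\<subseteq>V. colon V (ideal_gen V (set (take j (map ?m ds)))) (map ?m ds ! j) = ideal_gen V (var ` X)"
        unfolding take using j by (intro exI[of _ "{z\<in>V. \<exists>W\<in>S ` E. W \<subseteq> insert z (S (ds ! j))}"]) auto
    qed
  qed simp
qed

text \<open>A generator omitted from \<open>F\<close> would have to be divisible by a remaining one
  of the same degree, hence equal to it.\<close>

lemma min_homogeneous_gens_squarefree:
  fixes \<U> :: "'v set set"
  assumes V: "finite V" "\<And>W. W \<in> \<U> \<Longrightarrow> W \<subseteq> V" and card: "\<And>W. W \<in> \<U> \<Longrightarrow> card W = n"
  shows "min_homogeneous_gens V n (ideal_gen V (monom ` ind ` \<U>))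
    (monom ` ind ` \<U> :: ('v, 'k::comm_ring_1) mpoly set)"
proof -
  have fin: "finite W" if "W \<in> \<U>" for W
    using V that by (meson finite_subset)
  have "\<U> \<subseteq> Pow V"
    using V(2) by auto
  then have "finite \<U>"
    using V(1) by (meson finite_Pow_iff finite_subset)
  moreover have "ideal_gen V F \<noteq> ideal_gen V (monom ` ind ` \<U>)"
    if F: "F \<subset> monom ` ind ` \<U>" for F :: "('v, 'k) mpoly set"
  proof
    assume eq: "ideal_gen V F = ideal_gen V (monom ` ind ` \<U>)"
    obtain E where E: "E \<subseteq> \<U>" "F = monom ` ind ` E"
      using F by (metis psubset_imp_subset subset_image_iff)
    obtain W where W: "W \<in> \<U>" "W \<notin> E"
      using F E by blast
    have keysU: "\<forall>e\<in>ind ` \<U>. Poly_Mapping.keys e \<subseteq> V"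
      using V(2) fin by (fastforce simp: keys_ind)
    have keysE: "\<forall>e\<in>ind ` E. Poly_Mapping.keys e \<subseteq> V"
      using E keysU by blast
    have "(monom (ind W) :: ('v, 'k) mpoly) \<in> ideal_gen V (monom ` ind ` \<U>)"
      unfolding mem_ideal_gen_monom_iff[OF keysU] using W(1) keysU
      by (auto simp: polyring_monom intro: pp_le_refl)
    then obtain W' where W': "W' \<in> E" "pp_le (ind W') (ind W)"
      unfolding eq[symmetric] E mem_ideal_gen_monom_iff[OF keysE] by auto
    then have "ind W' = ind W"
      using W E fin card by (intro pp_le_mdeg_eq) (auto simp: mdeg_ind)
    moreover have "finite W'" "finite W"
      using W(1) W'(1) E(1) fin by auto
    ultimately show False
      using W(2) W'(1) by (simp add: ind_eq_iff)
  qed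
  ultimately show ?thesis
    unfolding min_homogeneous_gens_def using V fin card
    by (auto simp: homogeneous_def mdeg_ind polyring_monom keys_ind)
qed

text \<open>
  The relation between the generators of \<open>U\<close> and \<open>U'\<close> has coefficient \<open>x_(U' - U)\<close> at \<open>U\<close>, so some
  linear relation has a term \<open>z\<close> at \<open>U\<close> with \<open>z \<in> U' - U\<close>; another generator has to cancel it.
\<close>

lemma not_linearly_related_squarefree:
  fixes \<U> :: "'v set set"
  assumes V: "finite V" "\<And>W. W \<in> \<U> \<Longrightarrow> W \<subseteq> V" and card: "\<And>W. W \<in> \<U> \<Longrightarrow> card W = n"
    and U: "U \<in> \<U>" "U' \<in> \<U>" "U \<noteq> U'"
    and isolated: "\<And>z W. z \<in> U' - U \<Longrightarrow> W \<in> \<U> \<Longrightarrow> W \<subseteq> insert z U \<Longrightarrow> W = U"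
  shows "\<not> linearly_related V (ideal_gen V (monom ` ind ` \<U>) :: ('v, 'k::comm_ring_1) mpoly set)"
proof
  assume lin: "linearly_related V (ideal_gen V (monom ` ind ` \<U>) :: ('v, 'k) mpoly set)"
  define F :: "('v, 'k) mpoly set" where "F = monom ` ind ` \<U>"
  have gens: "min_homogeneous_gens V n (ideal_gen V F) F"
    unfolding F_def by (rule min_homogeneous_gens_squarefree) (use V card in auto)
  have finF: "finite F"
    using gens by (simp add: min_homogeneous_gens_def)
  have fin: "finite W" if "W \<in> \<U>" for W
    using V that by (meson finite_subset)
  let ?u = "monom (ind U) :: ('v, 'k) mpoly" and ?u' = "monom (ind U') :: ('v, 'k) mpoly"
  let ?m = "ind (U' - U)" and ?m' = "ind (U - U')"
  \<comment> \<open>The relation expressing the least common multiple of the two generators in two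
    ways.\<close>
  define s :: "('v, 'k) mpoly \<Rightarrow> ('v, 'k) mpoly"
    where "s = (\<lambda>f. if f = ?u then monom ?m else if f = ?u' then - monom ?m' else 0)"
  have ne: "?u \<noteq> ?u'"
    using U fin by (simp add: ind_eq_iff)
  have uF: "?u \<in> F" "?u' \<in> F"
    using U by (auto simp: F_def)
  have "?m + ind U = ?m' + ind U'"
    using U fin by (intro poly_mapping_eqI) (auto simp: lookup_add lookup_ind)
  then have "0 = (\<Sum>f\<in>{?u, ?u'}. s f * f)"
    using ne by (simp add: s_def monom_mult)
  also have "\<dots> = (\<Sum>f\<in>F. s f * f)"
    using finF uF by (intro sum.mono_neutral_left) (auto simp: s_def)
  finally have "(\<Sum>f\<in>F. s f * f) = 0" ..
  moreover have "s f \<in> polyring V" for f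
  proof -
    have "finite (U' - U)" "finite (U - U')" "U' - U \<subseteq> V" "U - U' \<subseteq> V"
      using U V fin by auto
    then have "(monom ?m :: ('v, 'k) mpoly) \<in> polyring V" "- (monom ?m' :: ('v, 'k) mpoly) \<in> polyring V"
      by (simp_all add: polyring_monom keys_ind polyring_uminus)
    then show ?thesis
      by (simp add: s_def polyring_0)
  qed
  moreover have "s f = 0" if "f \<notin> F" for f
    using that uF by (auto simp: s_def)
  ultimately have "s \<in> syzygies V F"
    by (simp add: syzygies_def)
  moreover have "syzygies V F = submodule_gen V (linear_syzygies V F)"
    using lin[folded F_def, unfolded linearly_related_def, rule_format, OF gens] .
  ultimately have "s \<in> submodule_gen V (linear_syzygies V F)"
    by simp
  then obtain T r where T: "T \<subseteq> linear_syzygies V F" and s: "s = (\<lambda>i. \<Sum>b\<in>T. r b * b i)"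
    by (auto simp: submodule_gen_def)
  have "s ?u = monom ?m"
    by (simp add: s_def)
  then have "?m \<in> Poly_Mapping.keys (s ?u)"
    by (simp only: keys_monom singletonI)
  then obtain b where b: "b \<in> T" "?m \<in> Poly_Mapping.keys (r b * b ?u)"
    unfolding s by (auto simp: in_keys_iff lookup_sum elim: sum.not_neutral_contains_not_neutral)
  have syz: "(\<Sum>f\<in>F. b f * f) = 0" and hom: "homogeneous 1 (b ?u)"
    using b T uF by (auto simp: linear_syzygies_def syzygies_def)
  \<comment> \<open>The term splits into a part from \<open>r b\<close> and a part \<open>d\<close>
    from the linear form \<open>b ?u\<close>; so \<open>d\<close> is a variable dividing
    \<open>x_(U' - U)\<close>.\<close>
  obtain c d where cd: "?m = c + d" "d \<in> Poly_Mapping.keys (b ?u)"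
    using b(2) keys_mult[of "r b" "b ?u"] by blast
  have "mdeg d = 1"
    using cd(2) hom unfolding homogeneous_def by blast
  then obtain z where z: "d = Poly_Mapping.single z 1"
    by (rule mdeg_eq_1)
  have "z \<in> Poly_Mapping.keys ?m"
    unfolding cd z by (simp add: keys_add_pp)
  then have zU: "z \<in> U' - U"
    using U fin by (simp add: keys_ind)
  \<comment> \<open>Compare coefficients of \<open>z x_U\<close> in the relation \<open>b\<close>:
    the one at \<open>?u\<close> is nonzero, so another generator contributes to this monomial and
    divides it.\<close>
  let ?k = "d + ind U"
  have "Poly_Mapping.lookup (b ?u * ?u) ?k \<noteq> 0"
    using cd by (simp add: lookup_mult_monom in_keys_iff)
  moreover have "(\<Sum>f\<in>F. Poly_Mapping.lookup (b f * f) ?k) = 0"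
    by (simp only: lookup_sum[symmetric] syz lookup_zero)
  ultimately have "(\<Sum>f\<in>F - {?u}. Poly_Mapping.lookup (b f * f) ?k) \<noteq> 0"
    using sum.remove[OF finF uF(1), of "\<lambda>f. Poly_Mapping.lookup (b f * f) ?k"] by auto
  then obtain f where f: "f \<in> F - {?u}" "Poly_Mapping.lookup (b f * f) ?k \<noteq> 0"
    by (auto elim: sum.not_neutral_contains_not_neutral)
  then obtain W where W: "W \<in> \<U>" "f = monom (ind W)" "W \<noteq> U"
    by (auto simp: F_def)
  have "?k \<in> Poly_Mapping.keys (b f * f)"
    using f by (simp add: in_keys_iff)
  then have "pp_le (ind W) ?k"
    unfolding W(2) keys_mult_monom by (auto simp: pp_le_iff_add)
  then have "W \<subseteq> insert z U"
    unfolding z using W U fin by (simp only: pp_le_ind_add_single)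
  then show False
    using isolated zU W by blast
qed

section \<open>Exchange between vertex sets of matchings\<close>

text \<open>The counts are written as sums so that \<open>sum_transfer\<close> applies to them just
  as to the degree.\<close>

definition ones :: "nat set \<Rightarrow> (nat \<Rightarrow> nat) \<Rightarrow> nat" where
  "ones X d = (\<Sum>v\<in>X. of_bool (d v = 1))"

definition zeros :: "nat set \<Rightarrow> (nat \<Rightarrow> nat) \<Rightarrow> nat" where
  "zeros X d = (\<Sum>v\<in>X. of_bool (d v = 0))"

definition twos :: "nat set \<Rightarrow> (nat \<Rightarrow> nat) \<Rightarrow> nat" where
  "twos X d = (\<Sum>v\<in>X. of_bool (d v = 2))"

text \<open>
  A vertex set \<open>U\<close> of a matching is encoded by \<open>d\<close>, where \<open>d v\<close> is the number of elements of
  \<open>{Inl v, Inr v}\<close> in \<open>U\<close>: since \<open>Inr v\<close> can only be matched with \<open>Inl v\<close>, the value \<open>1\<close> stands for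
  \<open>Inl v\<close>. The last condition is Hall's: each \<open>v \<in> B\<close> with \<open>d v = 1\<close> needs its own partner in \<open>C\<close>.
\<close>

definition profiles :: "nat set \<Rightarrow> nat set \<Rightarrow> nat \<Rightarrow> nat \<Rightarrow> (nat \<Rightarrow> nat) set" where
  "profiles B C q k = {d. (\<forall>v. d v \<le> 2) \<and> (\<forall>v\<ge>q. d v = 0) \<and> sum d {..<q} = 2 * k \<and> ones B d \<le> ones C d}"

definition ternary :: "nat \<Rightarrow> (nat \<Rightarrow> nat) \<Rightarrow> nat" where
  "ternary q d = (\<Sum>v<q. d v * 3 ^ v)"

text \<open>Triples are compared lexicographically. Transfers out of \<open>C\<close> lower the
  first component, transfers inside \<open>C\<close> one of the others. The third one alone
  separates profiles.\<close>

definition rank :: "nat set \<Rightarrow> nat \<Rightarrow> (nat \<Rightarrow> nat) \<Rightarrow> nat \<times> nat \<times> nat" where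
  "rank C q d = (sum d C, zeros C d, ternary q d)"

section \<open>Sums after changing two values\<close>

lemma sum_two_points:
  fixes f :: "'a \<Rightarrow> nat"
  assumes "finite X" and "v \<noteq> w"
  shows "sum f X = sum f (X - {v, w}) + (if v \<in> X then f v else 0) + (if w \<in> X then f w else 0)"
proof -
  have "sum f X = sum f (X - {v, w}) + sum f (X \<inter> {v, w})"
    using sum.Int_Diff[OF assms(1), of f "{v, w}"] by simp
  moreover have "sum f (X \<inter> {v, w}) = (if v \<in> X then f v else 0) + (if w \<in> X then f w else 0)"
    using assms(2) by (auto simp: Int_insert_right)
  ultimately show ?thesis
    by simp
qed

text \<open>The summand may depend on the position as well as on the value, which covers the weights
  \<open>3 ^ v\<close> of \<open>ternary\<close>.\<close>

lemma sum_transfer: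
  fixes f :: "nat \<Rightarrow> nat \<Rightarrow> nat"
  assumes "finite X" and "v \<noteq> w"
  shows "(\<Sum>x\<in>X. f x ((d(v := a, w := b)) x)) = (\<Sum>x\<in>X - {v, w}. f x (d x))
    + (if v \<in> X then f v a else 0) + (if w \<in> X then f w b else 0)"
proof -
  have "(\<Sum>x\<in>X - {v, w}. f x ((d(v := a, w := b)) x)) = (\<Sum>x\<in>X - {v, w}. f x (d x))"
    by (rule sum.cong) auto
  then show ?thesis
    using assms(2) by (subst sum_two_points[OF assms]) auto
qed

text \<open>Each of the values 0, 1, 2 satisfies the identity pointwise. Hence for a fixed degree on
  \<open>X\<close>, the numbers of zeros and of twos differ by a constant.\<close>

lemma sum_add_zeros:
  assumes "finite X" and "\<And>v. d v \<le> (2::nat)"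
  shows "sum d X + zeros X d = card X + twos X d"
proof -
  have "d v + of_bool (d v = 0) = 1 + of_bool (d v = 2)" for v
    using assms(2)[of v] by (auto simp: le_Suc_eq numeral_2_eq_2)
  then have "(\<Sum>v\<in>X. d v + of_bool (d v = 0)) = (\<Sum>v\<in>X. 1 + of_bool (d v = 2))"
    by simp
  then show ?thesis
    by (simp only: zeros_def twos_def sum.distrib card_eq_sum)
qed

section \<open>Ternary numbers and the order of profiles\<close>

lemma ternary_bound: "(\<And>v. d v \<le> 2) \<Longrightarrow> ternary q d < 3 ^ q"
proof (induction q)
  case (Suc q)
  have "d q * 3 ^ q \<le> 2 * 3 ^ q"
    using Suc.prems by simp
  moreover have "ternary q d < 3 ^ q"
    using Suc by blast
  ultimately have "ternary q d + d q * 3 ^ q < 3 ^ q + 2 * 3 ^ q"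
    by (rule add_less_le_mono[rotated])
  then show ?case
    by (simp add: ternary_def)
qed (simp add: ternary_def)

text \<open>The lower digits together weigh less than \<open>3 ^ q\<close>, so the top digit
  decides.\<close>

lemma ternary_leading:
  assumes "\<And>v. i v \<le> 2" and "\<And>v. j v \<le> 2" and "i q < j q"
  shows "ternary (Suc q) i < ternary (Suc q) j"
proof -
  have "(i q + 1) * 3 ^ q \<le> j q * 3 ^ q"
    using assms(3) by (intro mult_right_mono) auto
  then show ?thesis
    using ternary_bound[of i q] assms(1) by (simp add: ternary_def)
qed

lemma ternary_less_imp:
  assumes "\<And>v. i v \<le> 2" and "\<And>v. j v \<le> 2" and "ternary q i < ternary q j"
  shows "\<exists>w<q. i w < j w \<and> (\<forall>x. w < x \<and> x < q \<longrightarrow> i x = j x)"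
  using assms(3)
proof (induction q)
  case (Suc q)
  consider "i q < j q" | "i q = j q" | "j q < i q"
    by linarith
  then show ?case
  proof cases
    case 2
    then have "ternary q i < ternary q j"
      using Suc.prems by (simp add: ternary_def)
    then show ?thesis
      using Suc.IH 2 by (metis less_Suc_eq)
  next
    case 3
    then show ?thesis
      using ternary_leading[of j i q] assms Suc.prems by simp
  qed auto
qed (simp add: ternary_def)

lemma ternary_inject:
  assumes "\<And>v. i v \<le> 2" and "\<And>v. j v \<le> 2" and "ternary q i = ternary q j" and "x < q"
  shows "i x = j x"
  using assms(3,4)
proof (induction q)
  case (Suc q)
  have "i q = j q"
    using ternary_leading[of i j q] ternary_leading[of j i q] assms(1,2) Suc.prems
    by (metis less_irrefl linorder_neqE_nat)
  then show ?case
    using Suc by (auto simp: ternary_def less_Suc_eq)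
qed simp

lemma inj_on_rank: "inj_on (rank C q) (profiles B C q k)"
proof (rule inj_onI)
  fix i j assume ij: "i \<in> profiles B C q k" "j \<in> profiles B C q k" and "rank C q i = rank C q j"
  then have "i x = j x" if "x < q" for x
    using that by (intro ternary_inject[of i j q]) (auto simp: profiles_def rank_def)
  moreover have "i x = j x" if "\<not> x < q" for x
    using that ij by (auto simp: profiles_def)
  ultimately show "i = j"
    by blast
qed

text \<open>The injective \<open>rank\<close> sends profiles into a finite box.\<close>

lemma finite_profiles: "finite (profiles B C q k)"
proof (rule finite_imageD)
  have "rank C q ` profiles B C q k \<subseteq> {..2 * card C} \<times> {..card C} \<times> {..<3 ^ q}"
  proof (clarsimp simp: rank_def, intro conjI)
    fix d assume d: "d \<in> profiles B C q k"
    then have le: "\<And>v. d v \<le> 2"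
      by (simp add: profiles_def)
    show "sum d C \<le> 2 * card C"
      using sum_bounded_above[of C d 2] le by (simp add: mult.commute)
    show "zeros C d \<le> card C"
      using sum_bounded_above[of C "\<lambda>v. of_bool (d v = 0)" "1 :: nat"] by (simp add: zeros_def)
    show "ternary q d < 3 ^ q"
      using ternary_bound le by blast
  qed
  then show "finite (rank C q ` profiles B C q k)"
    by (rule finite_subset) auto
qed (rule inj_on_rank)

text \<open>Otherwise every zero of \<open>j\<close> would be one of \<open>i\<close>, which has the
  further zero \<open>w\<close>.\<close>

lemma ex_zero_not_zero:
  assumes "finite X" and "zeros X i \<le> zeros X j" and "w \<in> X" and "i w = 0" and "j w \<noteq> 0"
  shows "\<exists>v\<in>X. j v = 0 \<and> i v \<noteq> 0"
proof (rule ccontr)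
  assume "\<not> ?thesis"
  then have "zeros X j < zeros X i"
    unfolding zeros_def using assms by (intro sum_strict_mono_ex1) (auto intro!: bexI[of _ w])
  then show False
    using assms by simp
qed

lemma ex_twos: "0 < twos X d \<Longrightarrow> \<exists>w\<in>X. d w = 2"
  unfolding twos_def by (rule ccontr) simp

lemma twos_pos: "finite X \<Longrightarrow> w \<in> X \<Longrightarrow> d w = 2 \<Longrightarrow> 0 < twos X d"
  unfolding twos_def by (rule sum_pos2[of _ w]) auto

section \<open>The exchange property of profiles\<close>

locale whiskered_join =
  fixes B C :: "nat set" and q :: nat
  assumes B: "B \<subseteq> {..<q}" and C: "C \<subseteq> {..<q}" and BC: "B \<inter> C = {}"
begin

lemma finite_BC: "finite B" "finite C"
  using B C finite_subset by auto

text \<open>A transfer preserves the total, and the bounds at \<open>v\<close> and \<open>w\<close>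
  keep all values in range; only Hall's condition has to be assumed.\<close>

lemma transfer_mem_profiles:
  assumes j: "j \<in> profiles B C q k" and vw: "v \<noteq> w" "v < q" "w < q" and "j v < 2" "1 \<le> j w"
    and ones: "ones B (j(v := j v + 1, w := j w - 1)) \<le> ones C (j(v := j v + 1, w := j w - 1))"
  shows "j(v := j v + 1, w := j w - 1) \<in> profiles B C q k"
proof -
  have "sum (j(v := j v + 1, w := j w - 1)) {..<q} = sum j {..<q}"
    using sum_transfer[of "{..<q}" v w "\<lambda>_ x. x" j] sum_two_points[of "{..<q}" v w j] assms by simp
  moreover have "\<And>x. j x \<le> 2"
    using j by (auto simp: profiles_def)
  moreover have "j w - 1 \<le> 2"
    using calculation(2)[of w] by simp
  ultimately show ?thesis
    using assms by (auto simp: profiles_def)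
qed

text \<open>
  Only here \<open>k\<close> has to be large. If \<open>j\<close> has no value \<open>2\<close> on \<open>C\<close>, then \<open>ones C j = sum j C\<close> is at least
  the sum of \<open>2 - j x\<close> over all \<open>x\<close> outside \<open>C\<close>, which leaves room for one more unit at \<open>v\<close>.
\<close>

lemma exchange_outside:
  assumes k: "q \<le> k + card C" and j: "j \<in> profiles B C q k"
    and v: "v < q" "v \<notin> C" "j v < 2"
  shows "\<exists>w\<in>C. 1 \<le> j w \<and> j(v := j v + 1, w := j w - 1) \<in> profiles B C q k
    \<and> rank C q (j(v := j v + 1, w := j w - 1)) < rank C q j"
proof -
  \<comment> \<open>Moving a unit out of \<open>C\<close> lowers the first component of the rank, so
    only Hall's condition is left to check.\<close>
  have reduce: ?thesis if w: "w \<in> C" "1 \<le> j w"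
    "ones B (j(v := j v + 1, w := j w - 1)) \<le> ones C (j(v := j v + 1, w := j w - 1))" for w
  proof -
    have vw: "v \<noteq> w" "w < q"
      using w v C by auto
    have "sum (j(v := j v + 1, w := j w - 1)) C < sum j C"
      using sum_transfer[of C v w "\<lambda>_ x. x" j] sum_two_points[of C v w j] finite_BC v w vw by simp
    then show ?thesis
      using transfer_mem_profiles[OF j, of v w] w v vw by (auto simp: rank_def)
  qed
  have jB: "ones B j \<le> ones C j" and j2: "\<And>x. j x \<le> 2"
    using j by (auto simp: profiles_def)
  show ?thesis
  proof (cases "\<exists>w\<in>C. j w = 2")
    case True
    then obtain w where w: "w \<in> C" "j w = 2"
      by blast
    then have vw: "v \<noteq> w" "w \<notin> B"
      using v BC by auto
    \<comment> \<open>Turning the 2 at \<open>w\<close> into a 1 adds a one on \<open>C\<close>,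
      which pays for a possible new one at \<open>v\<close> in \<open>B\<close>.\<close>
    have "ones C (j(v := j v + 1, w := j w - 1)) = ones C j + 1"
      unfolding ones_def using sum_transfer[of C v w "\<lambda>_ x. of_bool (x = 1)" j]
        sum_two_points[of C v w "\<lambda>x. of_bool (j x = 1)"] finite_BC v w vw by simp
    moreover have "ones B (j(v := j v + 1, w := j w - 1)) \<le> ones B j + 1"
      unfolding ones_def using sum_transfer[of B v w "\<lambda>_ x. of_bool (x = 1)" j]
        sum_two_points[of B v w "\<lambda>x. of_bool (j x = 1)"] finite_BC v w vw by simp
    ultimately show ?thesis
      using reduce[of w] w jB by simp
  next
    case False
    define R where "R = {..<q} - C"
    have C1: "j x = of_bool (j x = 1)" if "x \<in> C" for x
      using False j2[of x] that by (auto simp: le_Suc_eq numeral_2_eq_2)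
    then have sumC: "sum j C = ones C j"
      unfolding ones_def by (intro sum.cong) auto
    have "card R + card C = q"
      using C finite_BC card_Diff_subset[of C "{..<q}"] card_mono[OF _ C] by (simp add: R_def)
    moreover have "sum j C + sum j R = 2 * k"
      using j C sum.subset_diff[of C "{..<q}" j] by (simp add: profiles_def R_def)
    \<comment> \<open>The sum of \<open>2 - j x\<close> is what \<open>j\<close> lacks on
      \<open>R\<close> to be 2 everywhere. As \<open>card R \<le> k\<close>, it is at most
      \<open>2 * k - sum j R = sum j C\<close>.\<close>
    moreover have "sum j R + (\<Sum>x\<in>R. 2 - j x) = 2 * card R"
      using j2 by (simp add: sum.distrib[symmetric])
    ultimately have defect: "(\<Sum>x\<in>R. 2 - j x) \<le> ones C j"
      using k sumC by linarith
    have vR: "v \<in> R" "finite R"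
      using v by (auto simp: R_def)
    \<comment> \<open>Every one in \<open>B\<close> other than \<open>v\<close> lacks 1, and
      \<open>v\<close> lacks \<open>2 - j v\<close> whether or not it lies in
      \<open>B\<close>.\<close>
    have "ones (B - {v}) j \<le> (\<Sum>x\<in>B - {v}. 2 - j x)"
      unfolding ones_def by (intro sum_mono) auto
    also have "\<dots> \<le> (\<Sum>x\<in>R - {v}. 2 - j x)"
      using vR B BC by (intro sum_mono2) (auto simp: R_def)
    finally have bound: "ones (B - {v}) j + (2 - j v) \<le> ones C j"
      using defect sum.remove[OF vR(2,1), of "\<lambda>x. 2 - j x"] by simp
    have "\<exists>w\<in>C. j w = 1"
    proof (rule ccontr)
      assume "\<not> ?thesis"
      then have "ones C j = 0"
        unfolding ones_def by (intro sum.neutral) auto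
      then show False
        using bound v by linarith
    qed
    then obtain w where w: "w \<in> C" "j w = 1"
      by blast
    then have vw: "v \<noteq> w" "w \<notin> B"
      using v BC by auto
    then have [simp]: "B - {v, w} = B - {v}"
      by auto
    have "ones C (j(v := j v + 1, w := j w - 1)) + 1 = ones C j"
      unfolding ones_def using sum_transfer[of C v w "\<lambda>_ x. of_bool (x = 1)" j]
        sum_two_points[of C v w "\<lambda>x. of_bool (j x = 1)"] finite_BC v w vw by simp
    \<comment> \<open>If \<open>j v = 0\<close>, \<open>bound\<close> has room for both the one lost
      at \<open>w\<close> and the one gained at \<open>v\<close>. If \<open>j v = 1\<close>, then
      \<open>v\<close> becomes 2 and only the loss at \<open>w\<close> counts.\<close>
    moreover have "ones B (j(v := j v + 1, w := j w - 1)) \<le> ones (B - {v}) j + of_bool (j v = 0)"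
      unfolding ones_def using sum_transfer[of B v w "\<lambda>_ x. of_bool (x = 1)" j] finite_BC vw
      by simp
    ultimately show ?thesis
      using reduce[of w] w bound v by (cases "j v = 0") auto
  qed
qed

text \<open>The profiles agree outside \<open>C\<close>, so their sums on \<open>C\<close> agree and
  the order is decided by zeros, then by the ternary number. Turning values 0 and 2 of
  \<open>j\<close> into 1 and 1 removes a zero; if that is impossible, a unit moves from the top
  differing position to a smaller one.\<close>

lemma exchange_inside:
  assumes i: "i \<in> profiles B C q k" and j: "j \<in> profiles B C q k"
    and eq: "\<And>x. x \<notin> C \<Longrightarrow> i x = j x" and less: "rank C q i < rank C q j"
  shows "\<exists>v w. v \<in> C \<and> w \<in> C \<and> v \<noteq> w \<and> j v < i v \<and> 1 \<le> j w \<and> j(v := j v + 1, w := j w - 1) \<in> profiles B C q k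
    \<and> rank C q (j(v := j v + 1, w := j w - 1)) < rank C q j"
proof -
  have jB: "ones B j \<le> ones C j" and le2: "\<And>x. i x \<le> 2" "\<And>x. j x \<le> 2"
    using i j by (auto simp: profiles_def)
  have "sum i {..<q} = sum j {..<q}"
    using i j by (simp add: profiles_def)
  moreover have "sum i ({..<q} - C) = sum j ({..<q} - C)"
    using eq by (intro sum.cong) auto
  ultimately have sumC: "sum i C = sum j C"
    using C sum.subset_diff[of C "{..<q}" i] sum.subset_diff[of C "{..<q}" j] by simp
  then have lex: "zeros C i < zeros C j \<or> zeros C i = zeros C j \<and> ternary q i < ternary q j"
    using less by (auto simp: rank_def)
  have counts: "sum i C + zeros C i = card C + twos C i" "sum j C + zeros C j = card C + twos C j"
    using sum_add_zeros finite_BC le2 by blast+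
  (* The excluded transfer 1, 1 to 2, 0 is the only one inside C that decreases ones C. *)
  have reduce: ?thesis if vw: "v \<in> C" "w \<in> C" "v \<noteq> w" "j v < i v" "1 \<le> j w"
    and not11: "\<not> (j v = 1 \<and> j w = 1)"
    and desc: "j v = 0 \<and> j w = 2 \<or> v < w \<and> (j v \<noteq> 0 \<or> j w \<noteq> 2)" for v w
  proof -
    let ?l = "j(v := j v + 1, w := j w - 1)"
    have lt: "v < q" "w < q" "j v < 2" "j w \<le> 2" and notB: "v \<notin> B" "w \<notin> B"
      using vw C BC le2(1)[of v] le2(2)[of w] by (auto simp del: le2)
    \<comment> \<open>What remains is 0, 2 to 1, 1, with one zero fewer, and the swaps 0, 1 to 1, 0
      and 1, 2 to 2, 1, which keep the zeros and lower the ternary number when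
      \<open>v < w\<close>.\<close>
    have vals: "j v = 0 \<and> (j w = 1 \<or> j w = 2) \<or> j v = 1 \<and> j w = 2"
      using lt vw not11 by linarith
    have "ones B ?l = ones B j"
      unfolding ones_def using sum_transfer[of B v w "\<lambda>_ x. of_bool (x = 1)" j]
        sum_two_points[of B v w "\<lambda>x. of_bool (j x = 1)"] finite_BC vw notB by simp
    moreover have "ones C j \<le> ones C ?l"
      unfolding ones_def using sum_transfer[of C v w "\<lambda>_ x. of_bool (x = 1)" j]
        sum_two_points[of C v w "\<lambda>x. of_bool (j x = 1)"] finite_BC vw vals by auto
    ultimately have "?l \<in> profiles B C q k"
      using transfer_mem_profiles[OF j vw(3) lt(1,2,3) vw(5)] jB by simp
    moreover have "sum ?l C = sum j C"
      using sum_transfer[of C v w "\<lambda>_ x. x" j] sum_two_points[of C v w j] finite_BC vw by simp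
    moreover have "zeros C ?l < zeros C j \<or> zeros C ?l = zeros C j \<and> ternary q ?l < ternary q j"
    proof -
      have z: "zeros C ?l = zeros (C - {v, w}) j + of_bool (j w = 1)"
        "zeros C j = zeros (C - {v, w}) j + of_bool (j v = 0)"
        unfolding zeros_def using sum_transfer[of C v w "\<lambda>_ x. of_bool (x = 0)" j]
          sum_two_points[of C v w "\<lambda>x. of_bool (j x = 0)"] finite_BC vw vals by auto
      show ?thesis
      proof (cases "j v = 0 \<and> j w = 2")
        case True
        then show ?thesis
          using z by simp
      next
        case False
        then have "v < w"
          using desc by blast
        then have "(3::nat) ^ v < 3 ^ w"
          by simp
        then have "(j v + 1) * 3 ^ v + (j w - 1) * 3 ^ w < j v * 3 ^ v + j w * 3 ^ w"
          using vals by auto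
        moreover have "ternary q ?l = (\<Sum>x\<in>{..<q} - {v, w}. j x * 3 ^ x) + (j v + 1) * 3 ^ v + (j w - 1) * 3 ^ w"
          unfolding ternary_def
          by (subst sum_transfer[where f = "\<lambda>y x. x * 3 ^ y"]) (use vw lt in simp_all)
        moreover have "ternary q j = (\<Sum>x\<in>{..<q} - {v, w}. j x * 3 ^ x) + j v * 3 ^ v + j w * 3 ^ w"
          unfolding ternary_def by (subst sum_two_points[OF _ vw(3)]) (use lt in simp_all)
        ultimately have "ternary q ?l < ternary q j"
          by linarith
        moreover have "of_bool (j w = 1) = (of_bool (j v = 0) :: nat)"
          using vals False by auto
        ultimately show ?thesis
          using z by simp
      qed
    qed
    ultimately show ?thesis
      using vw by (intro exI[of _ v] exI[of _ w]) (auto simp: rank_def)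
  qed
  show ?thesis
  proof (cases "\<exists>v\<in>C. \<exists>w\<in>C. j v = 0 \<and> i v \<noteq> 0 \<and> j w = 2")
    case True
    then obtain v w where "v \<in> C" "w \<in> C" "j v = 0" "i v \<noteq> 0" "j w = 2"
      by blast
    then show ?thesis
      by (intro reduce[of v w]) auto
  next
    case no_pair: False
    \<comment> \<open>If \<open>i\<close> had fewer zeros on \<open>C\<close>, then by
      \<open>counts\<close> \<open>j\<close> would have a two there, and also a zero where
      \<open>i\<close> is nonzero: the pair excluded by \<open>no_pair\<close>.\<close>
    have eqz: "zeros C i = zeros C j"
    proof (rule ccontr)
      assume "zeros C i \<noteq> zeros C j"
      then have lt: "zeros C i < zeros C j"
        using lex by simp
      then have "0 < twos C j"
        using counts sumC by simp
      moreover have "\<exists>v\<in>C. j v = 0 \<and> i v \<noteq> 0"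
      proof (rule ccontr)
        assume "\<not> ?thesis"
        then have "zeros C j \<le> zeros C i"
          unfolding zeros_def by (intro sum_mono) auto
        then show False
          using lt by simp
      qed
      ultimately show False
        using no_pair ex_twos by blast
    qed
    then have "ternary q i < ternary q j"
      using lex by simp
    then obtain w where w: "w < q" "i w < j w" and above: "\<forall>x. w < x \<and> x < q \<longrightarrow> i x = j x"
      using ternary_less_imp le2 by blast
    have "w \<in> C"
      using w eq by force
    \<comment> \<open>Equal totals force \<open>i\<close> to exceed \<open>j\<close> somewhere.
      Since \<open>i\<close> and \<open>j\<close> agree above \<open>w\<close>, this happens below
      \<open>w\<close>.\<close>
    have "\<exists>v<q. j v < i v"
    proof (rule ccontr)
      assume "\<not> ?thesis"
      then have "sum i {..<q} < sum j {..<q}"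
        using w by (intro sum_strict_mono_ex1) force+
      then show False
        using i j by (simp add: profiles_def)
    qed
    then obtain v where v: "v < q" "j v < i v"
      by blast
    then have "v \<in> C" "v < w"
      using eq[of v] above w by (force, metis less_irrefl linorder_neqE_nat less_asym)
    show ?thesis
    proof (rule reduce[of v w])
      \<comment> \<open>Here \<open>i v = 2\<close> and \<open>i w = 0\<close>. The zeros and twos
        on \<open>C\<close> are equally many for \<open>i\<close> and \<open>j\<close>, so
        \<open>j\<close> has a two in \<open>C\<close> and a zero where \<open>i\<close> is nonzero,
        against \<open>no_pair\<close>.\<close>
      show "\<not> (j v = 1 \<and> j w = 1)"
      proof
        assume "j v = 1 \<and> j w = 1"
        then have "i v = 2" "i w = 0" "j w \<noteq> 0"
          using v w le2(1)[of v] by auto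
        then have "0 < twos C i" "\<exists>v\<in>C. j v = 0 \<and> i v \<noteq> 0"
          using twos_pos[OF finite_BC(2) \<open>v \<in> C\<close>] ex_zero_not_zero[OF finite_BC(2) _ \<open>w \<in> C\<close>] eqz by auto
        moreover have "twos C i = twos C j"
          using counts sumC eqz by simp
        ultimately show False
          using no_pair ex_twos by metis
      qed
      show "j v = 0 \<and> j w = 2 \<or> v < w \<and> (j v \<noteq> 0 \<or> j w \<noteq> 2)"
        using \<open>v < w\<close> by blast
    qed (use \<open>v \<in> C\<close> \<open>w \<in> C\<close> v w \<open>v < w\<close> in auto)
  qed
qed

text \<open>If \<open>i\<close> nowhere exceeds \<open>j\<close> outside \<open>C\<close>, it does
  not exceed \<open>j\<close> in degree on \<open>C\<close> either, by the rank; equal totals then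
  give equality outside \<open>C\<close>, the situation of \<open>exchange_inside\<close>.\<close>

lemma exchange:
  assumes k: "q \<le> k + card C" and i: "i \<in> profiles B C q k" and j: "j \<in> profiles B C q k"
    and less: "rank C q i < rank C q j"
  shows "\<exists>v w. v \<noteq> w \<and> j v < i v \<and> 1 \<le> j w \<and> j(v := j v + 1, w := j w - 1) \<in> profiles B C q k
    \<and> rank C q (j(v := j v + 1, w := j w - 1)) < rank C q j"
proof (cases "\<exists>v. v \<notin> C \<and> j v < i v")
  case True
  then obtain v where v: "v \<notin> C" "j v < i v"
    by blast
  moreover have "i v \<le> 2" "v < q"
    using i v by (auto simp: profiles_def) (metis linorder_not_less not_less_zero)
  ultimately show ?thesis
    using exchange_outside[OF k j, of v] by (metis less_le_trans)
next
  case False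
  then have le: "i x \<le> j x" if "x \<notin> C" for x
    using that by (auto simp: not_less)
  have "sum i C \<le> sum j C"
    using less by (auto simp: rank_def)
  moreover have "sum i ({..<q} - C) \<le> sum j ({..<q} - C)"
    using le by (intro sum_mono) auto
  moreover have "sum i C + sum i ({..<q} - C) = sum j C + sum j ({..<q} - C)"
    using i j C sum.subset_diff[of C "{..<q}" i] sum.subset_diff[of C "{..<q}" j]
    by (simp add: profiles_def)
  ultimately have "sum i ({..<q} - C) = sum j ({..<q} - C)"
    by linarith
  then have "i x = j x" if "x \<in> {..<q} - C" for x
    using le that by (intro sum_mono_inv[of i "{..<q} - C" j]) auto
  moreover have "i x = j x" if "\<not> x < q" for x
    using i j that by (simp add: profiles_def)
  ultimately show ?thesis
    using exchange_inside[OF i j _ less] by blast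
qed

end

section \<open>Matchings of whiskered graphs\<close>

definition profile_vertices :: "(nat \<Rightarrow> nat) \<Rightarrow> (nat + nat) set" where
  "profile_vertices d = {Inl v | v. 1 \<le> d v} \<union> {Inr v | v. d v = 2}"

lemma mem_profile_vertices [simp]:
  "Inl v \<in> profile_vertices d \<longleftrightarrow> 1 \<le> d v" "Inr v \<in> profile_vertices d \<longleftrightarrow> d v = 2"
  by (auto simp: profile_vertices_def)

lemma eq_profile_verticesI:
  assumes "\<And>v. Inl v \<in> U \<longleftrightarrow> 1 \<le> d v" and "\<And>v. Inr v \<in> U \<longleftrightarrow> d v = 2"
  shows "U = profile_vertices d"
proof (rule set_eqI)
  show "x \<in> U \<longleftrightarrow> x \<in> profile_vertices d" for x
    using assms by (cases x) simp_all
qed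

lemma card_profile_vertices:
  assumes "\<And>v. d v \<le> 2" and "\<And>v. v \<ge> q \<Longrightarrow> d v = 0"
  shows "card (profile_vertices d) = sum d {..<q}"
proof -
  let ?P = "{v. v < q \<and> 1 \<le> d v}" and ?Q = "{v. v < q \<and> d v = 2}"
  have lt: "v < q" if "d v \<noteq> 0" for v
    using assms(2)[of v] that by (cases "v < q") auto
  have "Inl ` ?P \<union> Inr ` ?Q = profile_vertices d"
    using lt by (intro eq_profile_verticesI) auto
  moreover have "card (Inl ` ?P \<union> Inr ` ?Q :: (nat + nat) set) = card ?P + card ?Q"
    by (subst card_Un_disjoint) (auto simp: card_image)
  moreover have "sum d {..<q} = card ?P + card ?Q"
  proof -
    have "d v = of_bool (1 \<le> d v) + of_bool (d v = 2)" for v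
      using assms(1)[of v] by (auto simp: le_Suc_eq numeral_2_eq_2)
    then have "sum d {..<q} = (\<Sum>v<q. of_bool (1 \<le> d v) + of_bool (d v = 2))"
      by (intro sum.cong) auto
    then show ?thesis
      unfolding sum.distrib by (simp add: sum_of_bool_eq Int_def)
  qed
  ultimately show ?thesis
    by simp
qed

lemma inj_on_profile_vertices: "inj_on profile_vertices (profiles B C q k)"
proof (rule inj_onI)
  fix i j assume ij: "i \<in> profiles B C q k" "j \<in> profiles B C q k"
    and eq: "profile_vertices i = profile_vertices j"
  have "i v = j v" for v
  proof -
    have "1 \<le> i v \<longleftrightarrow> 1 \<le> j v" "i v = 2 \<longleftrightarrow> j v = 2"
      using eq by (metis mem_profile_vertices)+
    moreover have "i v \<le> 2" "j v \<le> 2"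
      using ij by (auto simp: profiles_def)
    ultimately show ?thesis
      by linarith
  qed
  then show "i = j"
    by blast
qed

section \<open>The edges in terms of \<open>B\<close> and \<open>C\<close>\<close>

definition whisker_edges :: "nat set \<Rightarrow> nat set \<Rightarrow> nat \<Rightarrow> (nat + nat) set set" where
  "whisker_edges B C q = {{Inl v, Inr v} | v. v < q} \<union>
    {{Inl v, Inl w} | v w. v < q \<and> w < q \<and> v \<noteq> w \<and> (v \<in> B \<longrightarrow> w \<in> C) \<and> (w \<in> B \<longrightarrow> v \<in> C)}"

lemma edges_G_graph:
  assumes "2 \<le> p" and "p \<le> c" and "c \<le> q"
  shows "edges (G_graph p c q) = whisker_edges {c - (p - 1)..<c} {c..<q} q"
proof -
  let ?B = "{c - (p - 1)..<c}" and ?C = "{c..<q}"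
  let ?\<Gamma> = "graph_join (complete_graph ?C) (H_graph p c)"
  have verts: "verts ?\<Gamma> = {..<q}"
    using assms by (auto simp: H_graph_def graph_join_def graph_union_def complete_graph_def
        edgeless_graph_def)
  have "edges ?\<Gamma> = {{v, w} | v w. v < q \<and> w < q \<and> v \<noteq> w \<and> (v \<in> ?B \<longrightarrow> w \<in> ?C) \<and> (w \<in> ?B \<longrightarrow> v \<in> ?C)}"
    (is "_ = ?E")
  proof (intro set_eqI iffI)
    fix e assume "e \<in> edges ?\<Gamma>"
    then show "e \<in> ?E"
      using assms by (fastforce simp: H_graph_def graph_join_def graph_union_def
          complete_graph_def edgeless_graph_def)
  next
    fix e assume "e \<in> ?E"
    then obtain v w where e: "e = {v, w}" "v < q" "w < q" "v \<noteq> w" "v \<in> ?B \<longrightarrow> w \<in> ?C" "w \<in> ?B \<longrightarrow> v \<in> ?C"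
      by blast
    have "verts (H_graph p c) = {..<c}"
      using assms by (auto simp: H_graph_def graph_union_def complete_graph_def edgeless_graph_def)
    then have edges: "edges ?\<Gamma> = {{x, y} | x y. x \<in> ?C \<and> y \<in> ?C \<and> x \<noteq> y} \<union>
        {{x, y} | x y. x < c - (p - 1) \<and> y < c - (p - 1) \<and> x \<noteq> y} \<union>
        {{x, y} | x y. x \<in> ?C \<and> y < c}"
      by (simp add: graph_join_def H_graph_def graph_union_def complete_graph_def edgeless_graph_def)
    \<comment> \<open>Without an endpoint in \<open>?C\<close>, neither endpoint can be in
      \<open>?B\<close>, so both lie in the complete component of \<open>H\<close>.\<close>
    consider "v \<in> ?C \<and> w \<in> ?C" | "v \<in> ?C \<and> w < c" | "w \<in> ?C \<and> v < c"
      | "v < c - (p - 1) \<and> w < c - (p - 1)"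
      using e by fastforce
    then show "e \<in> edges ?\<Gamma>"
      unfolding edges using e(1,4) by cases blast+
  qed
  moreover have "((`) Inl) ` {{v, w} | v w. P v w} = {{Inl v, Inl w} | v w. P v w}"
    for P :: "nat \<Rightarrow> nat \<Rightarrow> bool"
  proof -
    have "((`) Inl) ` {{v, w} | v w. P v w} = {Inl ` {v, w} | v w. P v w}"
      by blast
    then show ?thesis
      by simp
  qed
  ultimately have "((`) Inl) ` edges ?\<Gamma> =
    ({{Inl v, Inl w} | v w. v < q \<and> w < q \<and> v \<noteq> w \<and> (v \<in> ?B \<longrightarrow> w \<in> ?C) \<and> (w \<in> ?B \<longrightarrow> v \<in> ?C)} :: (nat + nat) set set)"
    by (simp only:)
  then show ?thesis
    unfolding G_graph_def add_whiskers_def whisker_edges_def by (simp add: verts Un_commute lessThan_def)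
qed

section \<open>Profiles are the vertex sets of matchings\<close>

context whiskered_join
begin

definition is_matching :: "(nat + nat) set set \<Rightarrow> bool" where
  "is_matching M \<longleftrightarrow> M \<subseteq> whisker_edges B C q \<and> pairwise disjnt M \<and> finite M"

text \<open>Let \<open>d\<close> count the covered ends of each whisker. A vertex of
  \<open>B\<close> with value 1 is matched to a vertex of \<open>C\<close> with value 1, and
  disjointness makes these partners distinct, whence Hall's condition.\<close>

lemma matching_vertices_profile:
  assumes M: "is_matching M" and card: "card M = k"
  shows "\<exists>d\<in>profiles B C q k. \<Union>M = profile_vertices d"
proof -
  define d where "d v = of_bool (Inl v \<in> \<Union>M) + (of_bool (Inr v \<in> \<Union>M) :: nat)" for v
  have edge: "e \<in> whisker_edges B C q" if "e \<in> M" for e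
    using M that by (auto simp: is_matching_def)
  have unique: "e = e'" if "e \<in> M" "e' \<in> M" "x \<in> e" "x \<in> e'" for e e' x
    using M that by (fastforce simp: is_matching_def pairwise_def disjnt_def)
  have lt: "v < q" if "Inl v \<in> \<Union>M \<or> Inr v \<in> \<Union>M" for v
    using that edge by (fastforce simp: whisker_edges_def)
  have whisker: "{Inl v, Inr v} \<in> M" if "Inr v \<in> \<Union>M" for v
  proof -
    from that obtain e where "e \<in> M" "Inr v \<in> e"
      by blast
    moreover from this have "e = {Inl v, Inr v}"
      using edge by (auto simp: whisker_edges_def)
    ultimately show ?thesis
      by simp
  qed
  have base: "Inl v \<in> \<Union>M" if "Inr v \<in> \<Union>M" for v
    using whisker[OF that] by blast
  have eq: "\<Union>M = profile_vertices d"
    using base by (intro eq_profile_verticesI) (simp_all add: d_def of_bool_def del: Union_iff)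
  have "card (\<Union>M) = 2 * k"
  proof -
    have c2: "card e = 2" if "e \<in> M" for e
      using edge[OF that] by (auto simp: whisker_edges_def card_insert_if)
    have "card (\<Union>M) = sum card M"
      using M c2 by (intro card_Union_disjoint) (auto simp: is_matching_def intro: card_ge_0_finite)
    then show ?thesis
      using c2 card by simp
  qed
  moreover have d2: "d v \<le> 2" for v
    by (simp add: d_def of_bool_def)
  moreover have d0: "d v = 0" if "v \<ge> q" for v
    using that lt[of v] unfolding d_def by (cases "v < q") (auto simp del: Union_iff)
  moreover have "card (\<Union>M) = sum d {..<q}"
    unfolding eq by (rule card_profile_vertices[OF d2 d0])
  moreover have "ones B d \<le> ones C d"
  proof -
    have partner: "\<exists>w. w \<in> C \<and> d w = 1 \<and> {Inl v, Inl w} \<in> M" if v: "v \<in> B" "d v = 1" for v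
    proof -
      have "Inl v \<in> \<Union>M" "Inr v \<notin> \<Union>M"
        using v(2) whisker[of v] by (auto simp: d_def of_bool_def split: if_splits)
      then obtain e where e: "e \<in> M" "Inl v \<in> e" "Inr v \<notin> e"
        by blast
      then obtain w where w: "e = {Inl v, Inl w}" "w \<in> C" "v \<noteq> w"
        using edge[OF e(1)] v(1) by (auto simp: whisker_edges_def)
      \<comment> \<open>\<open>Inr w\<close> could only be covered by its whisker, which meets
        \<open>e\<close> in \<open>Inl w\<close>.\<close>
      have "Inr w \<notin> \<Union>M"
      proof
        assume "Inr w \<in> \<Union>M"
        then have "{Inl w, Inr w} = e"
          using whisker[of w] unique[of "{Inl w, Inr w}" e "Inl w"] e w by blast
        then show False
          using w by (metis Inl_Inr_False insertCI insertE singletonD)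
      qed
      moreover have "Inl w \<in> \<Union>M"
        using e w by blast
      ultimately show ?thesis
        using e w by (auto simp: d_def)
    qed
    then obtain f where f: "\<And>v. v \<in> B \<Longrightarrow> d v = 1 \<Longrightarrow> f v \<in> C \<and> d (f v) = 1 \<and> {Inl v, Inl (f v)} \<in> M"
      by metis
    have "inj_on f {v\<in>B. d v = 1}"
    proof (rule inj_onI)
      fix v v' assume v: "v \<in> {v\<in>B. d v = 1}" "v' \<in> {v\<in>B. d v = 1}" "f v = f v'"
      then have "{Inl v, Inl (f v)} = ({Inl v', Inl (f v')} :: (nat + nat) set)"
        using v f[of v] f[of v'] by (intro unique[of _ _ "Inl (f v)"]) auto
      then show "v = v'"
        using v(3) by (auto simp: doubleton_eq_iff)
    qed
    moreover have "f ` {v\<in>B. d v = 1} \<subseteq> {v\<in>C. d v = 1}"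
      using f by auto
    ultimately have "card {v\<in>B. d v = 1} \<le> card {v\<in>C. d v = 1}"
      using finite_BC by (intro card_inj_on_le) auto
    moreover have "ones X d = card {v\<in>X. d v = 1}" if "finite X" for X
      using that by (simp add: ones_def sum_of_bool_eq Int_def)
    ultimately show ?thesis
      using finite_BC by (simp only:)
  qed
  ultimately have "d \<in> profiles B C q k"
    using d2 d0 unfolding profiles_def by simp
  then show ?thesis
    using eq by blast
qed

lemma insert_edge_matching:
  assumes "is_matching M" and "e \<in> whisker_edges B C q" and "e \<inter> \<Union>M = {}"
  shows "is_matching (insert e M)" and "e \<notin> M" and "card (insert e M) = Suc (card M)"
proof -
  have "e \<noteq> {}"
    using assms(2) by (auto simp: whisker_edges_def)
  then show "e \<notin> M"
    using assms(3) by blast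
  then show "card (insert e M) = Suc (card M)"
    using assms(1) by (simp add: is_matching_def)
  show "is_matching (insert e M)"
    using assms by (auto simp: is_matching_def pairwise_insert disjnt_def)
qed

text \<open>Split off one edge at a time: a whisker where the value is 2; if there is none, a one in
  \<open>B\<close> with a one in \<open>C\<close>, available by Hall's condition and lowering both
  counts; if \<open>B\<close> has no ones, any two ones, which are then adjacent.\<close>

lemma profile_vertices_matching:
  "d \<in> profiles B C q k \<Longrightarrow> \<exists>M. is_matching M \<and> card M = k \<and> \<Union>M = profile_vertices d"
proof (induction k arbitrary: d)
  case 0
  then have "d v = 0" for v
    by (cases "v < q") (auto simp: profiles_def)
  then have "profile_vertices d = {}"
    by (simp add: profile_vertices_def)
  then show ?case
    by (intro exI[of _ "{}"]) (simp add: is_matching_def)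
next
  case (Suc k)
  have le2: "d v \<le> 2" and supp: "v \<ge> q \<Longrightarrow> d v = 0" and sum: "sum d {..<q} = 2 * Suc k"
    and ones: "ones B d \<le> ones C d" for v
    using Suc.prems by (auto simp: profiles_def)
  have extend: ?case
    if d': "d' \<in> profiles B C q k" and e: "e \<in> whisker_edges B C q" "e \<inter> profile_vertices d' = {}"
      "e \<union> profile_vertices d' = profile_vertices d" for d' e
  proof -
    obtain M where "is_matching M" "card M = k" "\<Union>M = profile_vertices d'"
      using Suc.IH[OF d'] by blast
    then show ?thesis
      using insert_edge_matching[of M e] e by (intro exI[of _ "insert e M"]) auto
  qed
  have edge_case: ?case
    if vw: "v < q" "w < q" "v \<noteq> w" "d v = 1" "d w = 1" "v \<in> B \<longrightarrow> w \<in> C" "w \<in> B \<longrightarrow> v \<in> C"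
      and ones': "ones B (d(v := 0, w := 0)) \<le> ones C (d(v := 0, w := 0))" for v w
  proof (rule extend[of "d(v := 0, w := 0)" "{Inl v, Inl w}"])
    have "sum (d(v := 0, w := 0)) {..<q} = 2 * k"
      using sum_transfer[of "{..<q}" v w "\<lambda>_ x. x" d 0 0] sum_two_points[of "{..<q}" v w d] vw sum
      by simp
    then show "d(v := 0, w := 0) \<in> profiles B C q k"
      using le2 supp ones' by (simp add: profiles_def)
    show "{Inl v, Inl w} \<in> whisker_edges B C q"
      using vw by (auto simp: whisker_edges_def)
    show "{Inl v, Inl w} \<union> profile_vertices (d(v := 0, w := 0)) = profile_vertices d"
      using vw by (intro eq_profile_verticesI) auto
  qed simp
  show ?case
  proof (cases "\<exists>v. d v = 2")
    case True
    then obtain v where v: "d v = 2"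
      by blast
    then have vq: "v < q"
      using supp[of v] by (cases "v < q") auto
    show ?thesis
    proof (rule extend[of "d(v := 0)" "{Inl v, Inr v}"])
      have "sum (d(v := 0)) {..<q} = sum d ({..<q} - {v})"
        using vq by (subst sum.remove[of _ v]) (auto intro!: sum.cong)
      then have "sum (d(v := 0)) {..<q} = 2 * k"
        using sum.remove[of "{..<q}" v d] vq v sum by simp
      moreover have "ones X (d(v := 0)) = ones X d" for X
        unfolding ones_def using v by (intro sum.cong) auto
      ultimately show "d(v := 0) \<in> profiles B C q k"
        using le2 supp ones by (simp add: profiles_def)
      show "{Inl v, Inr v} \<in> whisker_edges B C q"
        using vq by (auto simp: whisker_edges_def)
      show "{Inl v, Inr v} \<union> profile_vertices (d(v := 0)) = profile_vertices d"
        using v by (intro eq_profile_verticesI) auto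
    qed simp
  next
    case False
    have le1: "d v \<le> 1" for v
      using le2[of v] False by (metis One_nat_def Suc_1 le_SucE)
    show ?thesis
    proof (cases "\<exists>b\<in>B. d b = 1")
      case True
      then obtain b where b: "b \<in> B" "d b = 1"
        by blast
      then have "0 < ones B d"
        unfolding ones_def using finite_BC by (intro sum_pos2[of _ b]) auto
      have "\<exists>c\<in>C. d c = 1"
      proof (rule ccontr)
        assume "\<not> ?thesis"
        then have "ones C d = 0"
          unfolding ones_def by (intro sum.neutral) auto
        then show False
          using ones \<open>0 < ones B d\<close> by simp
      qed
      then obtain c where c: "c \<in> C" "d c = 1"
        by blast
      have bc: "b \<noteq> c" "b \<notin> C" "c \<notin> B" "b < q" "c < q"
        using b c B C BC by auto
      show ?thesis
      proof (rule edge_case[of b c])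
        have "ones B (d(b := 0, c := 0)) + 1 = ones B d"
          unfolding ones_def
          using sum_transfer[of B b c "\<lambda>_ x. of_bool (x = 1)" d]
            sum_two_points[of B b c "\<lambda>x. of_bool (d x = 1)"] finite_BC b c bc by simp
        moreover have "ones C (d(b := 0, c := 0)) + 1 = ones C d"
          unfolding ones_def
          using sum_transfer[of C b c "\<lambda>_ x. of_bool (x = 1)" d]
            sum_two_points[of C b c "\<lambda>x. of_bool (d x = 1)"] finite_BC b c bc by simp
        ultimately show "ones B (d(b := 0, c := 0)) \<le> ones C (d(b := 0, c := 0))"
          using ones by simp
      qed (use b c bc in auto)
    next
      case noB: False
      have "sum d {..<q} = card {v. v < q \<and> d v = 1}"
      proof -
        have "d v = of_bool (d v = 1)" for v
          using le1[of v] by (auto simp: le_Suc_eq)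
        then have "sum d {..<q} = (\<Sum>v<q. of_bool (d v = 1))"
          by (intro sum.cong) auto
        then show ?thesis
          by (simp add: sum_of_bool_eq Int_def)
      qed
      then have "2 \<le> card {v. v < q \<and> d v = 1}"
        using sum by simp
      then obtain T where "T \<subseteq> {v. v < q \<and> d v = 1}" "card T = 2"
        by (meson obtain_subset_with_card_n)
      then obtain v w where vw: "v \<noteq> w" "v < q" "d v = 1" "w < q" "d w = 1"
        by (auto simp: card_2_iff)
      show ?thesis
      proof (rule edge_case[of v w])
        have "ones B (d(v := 0, w := 0)) = 0"
          unfolding ones_def using noB by (intro sum.neutral) auto
        then show "ones B (d(v := 0, w := 0)) \<le> ones C (d(v := 0, w := 0))"
          by simp
      qed (use vw noB in auto)
    qed
  qed
qed

lemma matching_vertices: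
  assumes "edges G = whisker_edges B C q"
  shows "\<Union> ` {M. k_matching G k M} = profile_vertices ` profiles B C q k"
proof -
  have "k_matching G k M \<longleftrightarrow> is_matching M \<and> card M = k" for M
    using assms by (auto simp: k_matching_def is_matching_def)
  then have matching: "{M. k_matching G k M} = {M. is_matching M \<and> card M = k}"
    by simp
  show ?thesis
    unfolding matching
  proof (intro equalityI image_subsetI)
    fix M assume "M \<in> {M. is_matching M \<and> card M = k}"
    then have "\<exists>d\<in>profiles B C q k. \<Union>M = profile_vertices d"
      by (intro matching_vertices_profile) simp_all
    then show "\<Union>M \<in> profile_vertices ` profiles B C q k"
      by (simp only: image_iff)
  next
    fix d assume "d \<in> profiles B C q k"
    then obtain M where "M \<in> {M. is_matching M \<and> card M = k}" "profile_vertices d = \<Union>M"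
      using profile_vertices_matching[of d k] by auto
    then show "profile_vertices d \<in> \<Union> ` {M. is_matching M \<and> card M = k}"
      by (rule rev_image_eqI)
  qed
qed

end

section \<open>The squarefree powers\<close>

lemma whiskered_join_G_graph:
  assumes "c \<le> q"
  shows "whiskered_join {c - (p - 1)..<c} {c..<q} q"
  using assms by unfold_locales auto

lemma verts_G_graph:
  assumes "c \<le> q"
  shows "verts (G_graph p c q) = Inl ` {..<q} \<union> Inr ` {..<q}"
proof -
  have "verts (graph_join (complete_graph {c..<q}) (H_graph p c)) = {..<q}"
    using assms by (auto simp: H_graph_def graph_join_def graph_union_def complete_graph_def
        edgeless_graph_def)
  then show ?thesis
    by (simp add: G_graph_def add_whiskers_def)
qed

lemma squarefree_power_G_graph:
  assumes "2 \<le> p" and "p \<le> c" and "c \<le> q"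
  shows "(squarefree_power (G_graph p c q) k :: (nat + nat, 'k::comm_ring_1) mpoly set) =
    ideal_gen (verts (G_graph p c q))
      (monom ` ind ` profile_vertices ` profiles {c - (p - 1)..<c} {c..<q} q k)"
proof -
  have "(matching_monomial M :: (nat + nat, 'k) mpoly) = monom (ind (\<Union>M))" for M
    by (simp add: matching_monomial_def prod_var)
  then have "matching_monomial ` {M. k_matching (G_graph p c q) k M} =
      (monom ` ind ` \<Union> ` {M. k_matching (G_graph p c q) k M} :: (nat + nat, 'k) mpoly set)"
    by (simp add: image_image)
  then show ?thesis
    unfolding squarefree_power_def
    using whiskered_join.matching_vertices[OF whiskered_join_G_graph edges_G_graph] assms by simp
qed

lemma profile_vertices_subset:
  assumes "c \<le> q" and "d \<in> profiles B C q k"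
  shows "profile_vertices d \<subseteq> verts (G_graph p c q)"
proof
  fix x assume x: "x \<in> profile_vertices d"
  have "v < q" if "d v \<noteq> 0" for v
    using assms(2) that by (cases "v < q") (auto simp: profiles_def)
  then show "x \<in> verts (G_graph p c q)"
    using x by (cases x) (auto simp: verts_G_graph[OF assms(1)])
qed

lemma card_profile_vertices_profiles:
  "d \<in> profiles B C q k \<Longrightarrow> card (profile_vertices d) = 2 * k"
  using card_profile_vertices[of d q] by (simp add: profiles_def)

lemma finite_verts_G_graph: "finite (verts (G_graph p c q))"
  using simple_graph_G_graph by (simp add: simple_graph_def)

lemma squarefree_power_G_graph_linear_quotients:
  assumes "2 \<le> p" and "p \<le> c" and "c \<le> q" and "c \<le> k"
  shows "has_linear_quotients (verts (G_graph p c q))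
    (squarefree_power (G_graph p c q) k :: (nat + nat, 'k::comm_ring_1) mpoly set)"
proof -
  let ?B = "{c - (p - 1)..<c}" and ?C = "{c..<q}"
  let ?D = "profiles ?B ?C q k"
  interpret whiskered_join ?B ?C q
    using assms by (intro whiskered_join_G_graph)
  show ?thesis
    unfolding squarefree_power_G_graph[OF assms(1-3)]
  proof (rule has_linear_quotients_squarefree[where rank = "rank ?C q"])
    fix i j assume i: "i \<in> ?D" and j: "j \<in> ?D" and less: "rank ?C q i < rank ?C q j"
    \<comment> \<open>Since \<open>card ?C = q - c\<close>, this is
      \<open>c \<le> k\<close>.\<close>
    have "q \<le> k + card ?C"
      using assms by simp
    then obtain v w where vw: "v \<noteq> w" "j v < i v" "1 \<le> j w"
      and l: "j(v := j v + 1, w := j w - 1) \<in> ?D"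
        "rank ?C q (j(v := j v + 1, w := j w - 1)) < rank ?C q j"
      using exchange[OF _ i j less] by blast
    \<comment> \<open>The only vertex gained by the transfer: \<open>Inl v\<close> when the value
      rises from 0, \<open>Inr v\<close> when it rises from 1. Lowering the value at
      \<open>w\<close> only removes a vertex.\<close>
    define z where "z = (if j v = 0 then Inl v else Inr v :: nat + nat)"
    have le2: "i x \<le> 2" "j x \<le> 2" for x
      using i j by (auto simp: profiles_def)
    have "z \<in> profile_vertices i - profile_vertices j"
      using vw(2) le2(1)[of v] by (auto simp: z_def)
    moreover have "profile_vertices (j(v := j v + 1, w := j w - 1)) \<subseteq> insert z (profile_vertices j)"
    proof
      fix x assume "x \<in> profile_vertices (j(v := j v + 1, w := j w - 1))"
      then show "x \<in> insert z (profile_vertices j)"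
        using vw le2(2)[of w] by (cases x) (auto simp: z_def split: if_splits)
    qed
    ultimately show "\<exists>z\<in>profile_vertices i - profile_vertices j. \<exists>l\<in>?D.
        rank ?C q l < rank ?C q j \<and> profile_vertices l \<subseteq> insert z (profile_vertices j)"
      using l by blast
  qed (use assms finite_verts_G_graph profile_vertices_subset card_profile_vertices_profiles finite_profiles
      inj_on_profile_vertices inj_on_rank in auto)
qed

lemma squarefree_power_G_graph_not_linearly_related:
  assumes "2 \<le> p" and "p \<le> c" and "c \<le> q" and "1 \<le> k" and "k < c"
  shows "\<not> linearly_related (verts (G_graph p c q))
    (squarefree_power (G_graph p c q) k :: (nat + nat, 'k::comm_ring_1) mpoly set)"
proof -
  let ?B = "{c - (p - 1)..<c}" and ?C = "{c..<q}"
  let ?D = "profiles ?B ?C q k"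
  \<comment> \<open>The \<open>k\<close> full whiskers just below position \<open>b\<close>. For
    \<open>b \<le> c\<close> they avoid \<open>?C\<close>, and with no value 1 Hall's condition is
    trivial.\<close>
  define whiskers :: "nat \<Rightarrow> nat \<Rightarrow> nat" where
    "whiskers b v = (if v \<in> {b - k..<b} then 2 else 0)" for b v
  have whiskers: "whiskers b \<in> ?D" if "k \<le> b" "b \<le> c" for b
  proof -
    have "{..<q} \<inter> {b - k..<b} = {b - k..<b}"
      using that assms(3) by auto
    then have "sum (whiskers b) {..<q} = sum (\<lambda>_. 2) {b - k..<b}"
      unfolding whiskers_def by (subst sum.inter_restrict[symmetric]) simp_all
    then have "sum (whiskers b) {..<q} = 2 * k"
      using that by simp
    moreover have "ones ?B (whiskers b) = 0"
      unfolding ones_def whiskers_def by (intro sum.neutral) auto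
    ultimately show ?thesis
      using that assms(3) by (auto simp: profiles_def whiskers_def)
  qed
  \<comment> \<open>The last vertex of \<open>H\<close>, isolated there as \<open>2 \<le> p\<close>.
    The windows ending before \<open>b\<close> and before \<open>c = b + 1\<close> are such that
    \<open>?U' - ?U\<close> is just the whisker at \<open>b\<close>.\<close>
  define b where "b = c - 1"
  have b: "b \<in> ?B" "Suc b = c" "k \<le> b"
    using assms by (auto simp: b_def)
  let ?U = "profile_vertices (whiskers b)" and ?U' = "profile_vertices (whiskers c)"
  have U: "whiskers b \<in> ?D" "whiskers c \<in> ?D"
    using whiskers b by auto
  show ?thesis
    unfolding squarefree_power_G_graph[OF assms(1-3)]
  proof (rule not_linearly_related_squarefree)
    show "?U \<in> profile_vertices ` ?D" "?U' \<in> profile_vertices ` ?D"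
      using U by auto
    have "Inl b \<in> ?U'" "Inl b \<notin> ?U"
      using assms b by (auto simp: whiskers_def)
    then show "?U \<noteq> ?U'"
      by blast
  next
    fix z W assume z: "z \<in> ?U' - ?U" and "W \<in> profile_vertices ` ?D" and sub: "W \<subseteq> insert z ?U"
    then obtain d where d: "d \<in> ?D" and W: "W = profile_vertices d"
      by blast
    have "z = Inl b \<or> z = Inr b"
    proof (cases z)
      case (Inl v)
      then have "v \<in> {c - k..<c}" "v \<notin> {b - k..<b}"
        using z by (auto simp: whiskers_def split: if_splits)
      then show ?thesis
        using Inl b by auto
    next
      case (Inr v)
      then have "v \<in> {c - k..<c}" "v \<notin> {b - k..<b}"
        using z by (auto simp: whiskers_def split: if_splits)
      then show ?thesis
        using Inr b by auto
    qed
    have below: "v \<le> b" if "1 \<le> d v" for v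
    proof -
      have "Inl v \<in> insert z ?U"
        using subsetD[OF sub, of "Inl v"] that by (simp only: W mem_profile_vertices)
      then show ?thesis
        using \<open>z = Inl b \<or> z = Inr b\<close> by (auto simp: whiskers_def split: if_splits)
    qed
    have not_both: "\<not> {Inl b, Inr b} \<subseteq> W"
      using sub \<open>z = Inl b \<or> z = Inr b\<close> by (auto simp: whiskers_def split: if_splits)
    \<comment> \<open>Containing \<open>z\<close> but not the whole whisker, \<open>W\<close> would
      have value 1 at \<open>b\<close> in \<open>?B\<close>, while by \<open>below\<close> it has no
      vertices over \<open>?C\<close>; this violates Hall's condition.\<close>
    have "z \<notin> W"
    proof
      assume "z \<in> W"
      then have "1 \<le> d b"
        using \<open>z = Inl b \<or> z = Inr b\<close> by (auto simp: W)
      moreover have "d b \<noteq> 2"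
        using not_both by (auto simp: W)
      moreover have "d b \<le> 2"
        using d by (simp add: profiles_def)
      ultimately have "d b = 1"
        by linarith
      then have "0 < ones ?B d"
        unfolding ones_def using b by (intro sum_pos2[of _ b]) auto
      moreover have "ones ?C d = 0"
        unfolding ones_def
      proof (intro sum.neutral ballI)
        show "of_bool (d v = 1) = (0 :: nat)" if "v \<in> ?C" for v
          using below[of v] b(2) that by auto
      qed
      ultimately show False
        using d by (simp add: profiles_def)
    qed
    then have "W \<subseteq> ?U"
      using sub by blast
    moreover have "finite ?U" "card W = card ?U"
      using finite_subset[OF profile_vertices_subset finite_verts_G_graph] U(1) assms(3) d W
        card_profile_vertices_profiles by auto
    ultimately show "W = ?U"
      by (simp add: card_subset_eq)
  next
    show "finite (verts (G_graph p c q))"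
      by (rule finite_verts_G_graph)
  next
    fix W assume "W \<in> profile_vertices ` ?D"
    then show "W \<subseteq> verts (G_graph p c q)" and "card W = 2 * k"
      using profile_vertices_subset[OF assms(3)] card_profile_vertices_profiles by blast+
  qed
qed

theorem theorem2p6:
  fixes p c q :: nat
  assumes "2 \<le> p" and "p \<le> c" and "c \<le> q"
  shows "(\<forall>k. c \<le> k \<and> k \<le> q \<longrightarrow>
            has_linear_quotients (verts (G_graph p c q))
              (squarefree_power (G_graph p c q) k :: (nat + nat, 'k::field) mpoly set)) \<and>
         (\<forall>k. 1 \<le> k \<and> k < c \<longrightarrow>
            \<not> linearly_related (verts (G_graph p c q))
              (squarefree_power (G_graph p c q) k :: (nat + nat, 'k::field) mpoly set))"
  using assms squarefree_power_G_graph_linear_quotients squarefree_power_G_graph_not_linearly_related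
  by blast

end
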